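(* Fix a positive integer $n$. For each $k\in\mathbb{N}^+$ let $0\le r_{k_1}\le r_{k_2}\le\cdots\le r_{k_n}\le1$ be real numbers, and let $h_{n,k}(x)$ be the polynomial defined by $$\sum_{m\ge0}\prod_{i=1}^n(m+r_{k_i})\,x^m=\frac{h_{n,k}(x)}{(1-x)^{n+1}}.$$ Let $p\in\mathbb{R}[x]$ have the expression $p=\sum_{k\ge1}c_kh_{n,k}(x)$ with all $c_k\ge0$ (finitely many nonzero), and let $(a,b)$ be the $\mathcal{I}_n$-decomposition of $p$. If $0\le r_{k_i}+r_{\ell_{n-i+1}}\le1$ for all $k,\ell\in\mathbb{N}^+$ and all $1\le i\le n$, then $\mathcal{I}_n(p)\ll p$ for $\deg(p)=n$. In particular, $b\ll a$ and $p$ is alternatingly increasing.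
   Context: For $p$ of degree at most $n$, $\mathcal{I}_n(p)(x)=x^np(1/x)$. The $\mathcal{I}_n$-decomposition of $p$ is the unique pair $(a,b)$ of polynomials with $p=a+xb$, $\mathcal{I}_n(a)=a$ and $\mathcal{I}_{n-1}(b)=b$. For real-rooted real polynomials $f,g$ with zeros $\{r_i\}$, $\{s_j\}$ in decreasing order, $g\preceq f$ means either $\deg f=\deg g+1=d$ and $r_d\le s_{d-1}\le\cdots\le s_1\le r_1$, or $\deg f=\deg g=d$ and $s_d\le r_d\le\cdots\le s_1\le r_1$; $g\ll f$ means $g\preceq f$ with leading coefficients of the same sign, or $f\preceq g$ with leading coefficients of opposite sign; by convention $0\ll f$ and $f\ll 0$ for real-rooted $f$. A polynomial $p=\sum_{k=0}^np_kx^k$ of degree $n$ is alternatingly increasing if $0\le p_0\le p_n\le p_1\le p_{n-1}\le\cdots\le p_{\lfloor(n+1)/2\rfloor}$. *)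

theory Defs
  imports Complex_Main "HOL-Computational_Algebra.Computational_Algebra"
begin

definition hpoly_eq :: "nat \<Rightarrow> (nat \<Rightarrow> real) \<Rightarrow> real poly \<Rightarrow> bool" where
  "hpoly_eq n \<rho> h \<longleftrightarrow>
     Abs_fps (\<lambda>m. \<Prod>i=1..n. (real m + \<rho> i)) = fps_of_poly h / (1 - fps_X) ^ (n + 1)"

definition hpoly :: "nat \<Rightarrow> (nat \<Rightarrow> real) \<Rightarrow> real poly" where
  "hpoly n \<rho> = (THE h. hpoly_eq n \<rho> h)"

lemma hpoly_eq_iff:
  "hpoly_eq n \<rho> h \<longleftrightarrow>
     fps_of_poly h = Abs_fps (\<lambda>m. \<Prod>i=1..n. (real m + \<rho> i)) * (1 - fps_X) ^ (n + 1)"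
proof -
  let ?F = "Abs_fps (\<lambda>m. \<Prod>i=1..n. (real m + \<rho> i))" and ?G = "(1 - fps_X :: real fps) ^ (n + 1)"
  have nz: "?G $ 0 \<noteq> 0" by (simp add: fps_nth_power_0)
  have inv: "?G * inverse ?G = 1" using nz by (rule inverse_mult_eq_1')
  have div: "fps_of_poly h / ?G = fps_of_poly h * inverse ?G"
    using nz by (rule fps_divide_unit)
  show ?thesis unfolding hpoly_eq_def div
  proof
    assume "?F = fps_of_poly h * inverse ?G"
    hence "?F * ?G = fps_of_poly h * (?G * inverse ?G)" by (simp only: mult_ac)
    thus "fps_of_poly h = ?F * ?G" by (simp only: inv mult_1_right)
  next
    assume "fps_of_poly h = ?F * ?G"
    hence "fps_of_poly h * inverse ?G = ?F * (?G * inverse ?G)" by (simp only: mult_ac)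
    thus "?F = fps_of_poly h * inverse ?G" by (simp only: inv mult_1_right)
  qed
qed

lemma hpoly_exists: "\<exists>h. hpoly_eq n \<rho> h"
proof (induction n)
  case 0
  have "fps_of_poly 1 = Abs_fps (\<lambda>m. 1) * (1 - fps_X :: real fps)"
    by (rule fps_ext) (auto simp: algebra_simps fps_X_mult_nth)
  thus ?case by (intro exI[of _ 1]) (simp add: hpoly_eq_iff)
next
  case (Suc n)
  then obtain h where "hpoly_eq n \<rho> h" by blast
  define F where "F = Abs_fps (\<lambda>m. \<Prod>i=1..n. (real m + \<rho> i))"
  define G :: "real fps" where "G = (1 - fps_X) ^ (n + 1)"
  define r where "r = \<rho> (Suc n)"
  have H: "fps_of_poly h = F * G"
    using \<open>hpoly_eq n \<rho> h\<close> by (simp add: hpoly_eq_iff F_def G_def)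
  have F': "Abs_fps (\<lambda>m. \<Prod>i=1..Suc n. (real m + \<rho> i)) = fps_X * fps_deriv F + fps_const r * F"
    by (rule fps_ext) (auto simp: F_def r_def algebra_simps fps_X_mult_nth)
  have G': "(1 - fps_X) * fps_deriv G = - (of_nat (n + 1) * G)"
  proof -
    have "fps_deriv G = - (of_nat (n + 1) * (1 - fps_X) ^ n)"
      unfolding G_def fps_deriv_power' by (simp flip: mult_minus_left)
    moreover have "G = (1 - fps_X) * (1 - fps_X) ^ n"
      by (simp add: G_def)
    ultimately show ?thesis
      by (simp only: mult_minus_right mult.left_commute)
  qed
  define k where
    "k = [:0, 1:] * [:1, -1:] * pderiv h + of_nat (n + 1) * [:0, 1:] * h + [:r:] * [:1, -1:] * h"
  have lin: "fps_of_poly [:1, -1:] = (1 - fps_X :: real fps)"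
    by (simp add: fps_of_poly_linear')
  have nat: "fps_of_poly (of_nat m :: real poly) = of_nat m" for m
    by (induction m) (simp_all add: fps_of_poly_add)
  have "fps_of_poly k = fps_X * (1 - fps_X) * fps_deriv (F * G)
      + of_nat (n + 1) * fps_X * (F * G) + fps_const r * (1 - fps_X) * (F * G)"
    unfolding k_def fps_of_poly_add fps_of_poly_mult fps_of_poly_pderiv lin nat H fps_of_poly_const
    by simp
  also have "fps_X * (1 - fps_X) * fps_deriv (F * G) =
      fps_X * (1 - fps_X) * fps_deriv F * G + fps_X * F * ((1 - fps_X) * fps_deriv G)"
    by (simp add: algebra_simps)
  also have "fps_X * (1 - fps_X) * fps_deriv F * G + fps_X * F * ((1 - fps_X) * fps_deriv G)
       + of_nat (n + 1) * fps_X * (F * G) + fps_const r * (1 - fps_X) * (F * G)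
     = (fps_X * fps_deriv F + fps_const r * F) * ((1 - fps_X) * G)"
    unfolding G' by (simp only: ring_distribs mult_minus_right mult_1_left mult_1_right) (simp add: mult_ac)
  finally have "hpoly_eq (Suc n) \<rho> k"
    unfolding hpoly_eq_iff F' by (simp add: G_def)
  thus ?case ..
qed

lemma hpoly_unique: "\<exists>!h. hpoly_eq n \<rho> h"
proof (rule ex_ex1I[OF hpoly_exists])
  fix h k assume "hpoly_eq n \<rho> h" "hpoly_eq n \<rho> k"
  hence "fps_of_poly h = fps_of_poly k" by (simp only: hpoly_eq_iff)
  thus "h = k" by (simp only: fps_of_poly_eq_iff)
qed

lemma hpoly: "hpoly_eq n \<rho> (hpoly n \<rho>)"
  unfolding hpoly_def by (rule theI'[OF hpoly_unique])

definition Inv_poly :: "nat \<Rightarrow> real poly \<Rightarrow> real poly" where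
  "Inv_poly n p = (\<Sum>k\<le>n. monom (coeff p k) (n - k))"

lemma poly_Inv_poly:
  assumes "degree p \<le> n" "x \<noteq> 0"
  shows "poly (Inv_poly n p) x = x ^ n * poly p (1 / x)"
proof -
  have "poly p (1 / x) = (\<Sum>k\<le>n. coeff p k * (1 / x) ^ k)"
    using arg_cong[OF poly_as_sum_of_monoms'[OF assms(1)], of "\<lambda>q. poly q (1 / x)"]
    unfolding poly_sum poly_monom by (rule sym)
  moreover have "x ^ (n - k) = x ^ n * (1 / x) ^ k" if "k \<le> n" for k
    using that assms(2) by (simp add: power_diff power_divide)
  ultimately show ?thesis
    by (simp only: Inv_poly_def poly_sum poly_monom sum_distrib_left)
      (intro sum.cong refl, simp)
qed

definition is_I_decomp :: "nat \<Rightarrow> real poly \<Rightarrow> real poly \<Rightarrow> real poly \<Rightarrow> bool" where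
  "is_I_decomp n p a b \<longleftrightarrow>
     p = a + [:0, 1:] * b \<and>
     degree a \<le> n \<and> Inv_poly n a = a \<and>
     degree b \<le> n - 1 \<and> Inv_poly (n - 1) b = b"

definition real_rooted :: "real poly \<Rightarrow> bool" where
  "real_rooted p \<longleftrightarrow> (\<forall>z::complex. poly (map_poly of_real p) z = 0 \<longrightarrow> z \<in> \<real>)"

definition zeros_desc :: "real poly \<Rightarrow> real list" where
  "zeros_desc p = rev (sorted_list_of_multiset (proots p))"

(* Lists are indexed from 0: r ! i and s ! i are the (i+1)-st largest zeros of f and g. *)
definition interlaces :: "real poly \<Rightarrow> real poly \<Rightarrow> bool" (infix "\<preceq>" 50) where
  "g \<preceq> f \<longleftrightarrow> real_rooted f \<and> real_rooted g \<and>
     (let r = zeros_desc f; s = zeros_desc g; d = degree f in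
        d = degree g + 1 \<and> (\<forall>i<d - 1. r ! Suc i \<le> s ! i \<and> s ! i \<le> r ! i) \<or>
        d = degree g \<and> (\<forall>i<d. s ! i \<le> r ! i) \<and> (\<forall>i<d - 1. r ! Suc i \<le> s ! i))"

definition ll :: "real poly \<Rightarrow> real poly \<Rightarrow> bool" (infix "\<lless>" 50) where
  "g \<lless> f \<longleftrightarrow>
     g = 0 \<and> real_rooted f \<or>
     f = 0 \<and> real_rooted g \<or>
     g \<preceq> f \<and> sgn (lead_coeff g) = sgn (lead_coeff f) \<or>
     f \<preceq> g \<and> sgn (lead_coeff g) = - sgn (lead_coeff f)"

(* The indices 0, n, 1, n - 1, 2, ... in the order of the chain, ending with (n + 1) div 2
   at position n. *)
definition alt_index :: "nat \<Rightarrow> nat \<Rightarrow> nat" where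
  "alt_index n j = (if even j then j div 2 else n - j div 2)"

definition alternatingly_increasing :: "real poly \<Rightarrow> bool" where
  "alternatingly_increasing p \<longleftrightarrow>
     0 \<le> coeff p 0 \<and>
     (\<forall>j<degree p. coeff p (alt_index (degree p) j) \<le> coeff p (alt_index (degree p) (Suc j)))"

lemma alt_index_last: "alt_index n n = (n + 1) div 2"
  unfolding alt_index_def by presburger

end

theory Submission
  imports Defs "HOL-Complex_Analysis.Conformal_Mappings"
begin

text \<open>
  For polynomials without common zeros in the upper half-plane, \<open>g \<lless> f\<close> follows from
  \<open>Im (f z * cnj (g z)) \<ge> 0\<close> for all \<open>z\<close> with \<open>Im z > 0\<close>; unlike interlacing, this condition is
  bilinear in \<open>f\<close> and \<open>g\<close> and can be checked one point \<open>z\<close> at a time.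
  The polynomial \<open>h\<close> attached to \<open>r\<^sub>1, \<dots>, r\<^sub>n\<close> is symmetric and multiaffine in the \<open>r\<^sub>i\<close>, hence a convex
  combination of the polynomials \<open>E\<^sub>k\<close> for \<open>k\<close> ones and \<open>n - k\<close> zeros. Their recursion shows that
  at \<open>z\<close> the arguments of \<open>E\<^sub>0, \<dots>, E\<^sub>n\<close> decrease, and that their total drop is \<open>arg z < \<pi>\<close>,
  since \<open>E\<^sub>0 = x E\<^sub>n\<close>. Therefore all \<open>h\<close> lie in one pointed cone, in which raising the parameters lowers
  the argument.

  Since \<open>I\<^sub>n\<close> replaces \<open>r\<^sub>i\<close> by \<open>1 - r\<^sub>i\<close>, the hypothesis on \<open>r\<close> gives \<open>I\<^sub>n(p) \<lless> p\<close>. With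
  \<open>q = I\<^sub>n(p)\<close> we have \<open>(x - 1) b = p - q\<close> and \<open>(x - 1) a = x q - p\<close>, and changing the parameters one
  at a time writes \<open>a\<close> and \<open>b\<close> as positive combinations of polynomials \<open>h\<close> for \<open>n - 1\<close> parameters;
  this yields \<open>b \<lless> a\<close>. Finally, \<open>a\<close> and \<open>b\<close> are real-rooted with nonnegative
  coefficients, hence log-concave, and being symmetric they increase up to the middle, which is what
  alternatingly increasing means for \<open>p = a + x b\<close>.
\<close>

section \<open>The polynomials \<open>h\<close> as functions of their parameters\<close>

text \<open>A list version of \<open>hpoly\<close>, so that single parameters can be permuted,
  dropped or appended. List positions start at 0, hence \<open>i - 1\<close>.\<close>

definition hp :: "real list \<Rightarrow> real poly" where
  "hp rs = hpoly (length rs) (\<lambda>i. rs ! (i - 1))"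

lemma fps_of_poly_hp:
  "fps_of_poly (hp rs) = Abs_fps (\<lambda>m. \<Prod>r\<leftarrow>rs. real m + r) * (1 - fps_X) ^ (length rs + 1)"
proof -
  have "(\<Prod>i=1..length rs. real m + rs ! (i - 1)) = (\<Prod>r\<leftarrow>rs. real m + r)" for m
  proof -
    have "(\<Prod>i=1..length rs. real m + rs ! (i - 1)) = (\<Prod>i<length rs. real m + rs ! i)"
      by (rule prod.reindex_bij_witness[of _ Suc "\<lambda>i. i - 1"]) auto
    thus ?thesis by (simp add: prod.list_conv_set_nth atLeast0LessThan)
  qed
  thus ?thesis using hpoly[of "length rs" "\<lambda>i. rs ! (i - 1)"]
    unfolding hpoly_eq_iff hp_def by simp
qed

lemma hpoly_conv_hp: "hpoly n \<rho> = hp (map \<rho> [1..<Suc n])"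
proof -
  have "hpoly_eq n \<rho> = hpoly_eq n (\<lambda>i. map \<rho> [1..<Suc n] ! (i - 1))"
    unfolding hpoly_eq_def by (intro ext arg_cong2[where f = "(=)"] arg_cong[where f = Abs_fps] prod.cong refl) (auto simp del: upt_Suc)
  thus ?thesis unfolding hp_def hpoly_def by (simp del: upt_Suc)
qed

lemma hp_mset_cong:
  assumes "mset rs = mset ss"
  shows "hp rs = hp ss"
proof -
  have "(\<Prod>r\<leftarrow>rs. real m + r) = (\<Prod>r\<leftarrow>ss. real m + r)" for m
    using assms by (metis mset_map prod_mset_prod_list)
  moreover have "length rs = length ss" using assms by (rule mset_eq_length)
  ultimately show ?thesis by (simp flip: fps_of_poly_eq_iff add: fps_of_poly_hp)
qed

lemma hp_Nil [simp]: "hp [] = 1"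
proof -
  have "Abs_fps (\<lambda>m. 1) * (1 - fps_X :: real fps) = 1"
    by (rule fps_ext) (auto simp: algebra_simps fps_X_mult_nth)
  thus ?thesis by (simp flip: fps_of_poly_eq_iff add: fps_of_poly_hp)
qed

lemma fps_of_poly_linear_minus: "fps_of_poly [:1, -1:] = (1 - fps_X :: real fps)"
  by (simp add: fps_of_poly_linear')

text \<open>The factors m + c and m + d differ by the constant c - d. The series for
  \<open>s\<close> has one parameter less and needs one power of 1 - x less, which leaves the factor
  1 - x.\<close>

lemma hp_Cons_diff: "hp (c # s) - hp (d # s) = smult (c - d) ([:1, -1:] * hp s)"
proof -
  have "Abs_fps (\<lambda>m. \<Prod>r\<leftarrow>c # s. real m + r) - Abs_fps (\<lambda>m. \<Prod>r\<leftarrow>d # s. real m + r)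
     = fps_const (c - d) * Abs_fps (\<lambda>m. \<Prod>r\<leftarrow>s. real m + r)"
    by (rule fps_ext) (simp add: algebra_simps)
  hence "fps_of_poly (hp (c # s) - hp (d # s)) =
      (fps_const (c - d) * Abs_fps (\<lambda>m. \<Prod>r\<leftarrow>s. real m + r)) * (1 - fps_X) ^ (length s + 2)"
    by (simp only: fps_of_poly_diff fps_of_poly_hp left_diff_distrib[symmetric] length_Cons add_Suc
          add_Suc_right numeral_2_eq_2 One_nat_def)
  also have "\<dots> = fps_of_poly (smult (c - d) ([:1, -1:] * hp s))"
    by (simp only: fps_of_poly_smult fps_of_poly_mult fps_of_poly_hp fps_of_poly_linear_minus) (simp add: mult_ac)
  finally show ?thesis by (simp only: fps_of_poly_eq_iff)
qed

lemma hp_Cons_affine: "hp (c # s) = smult (1 - c) (hp (0 # s)) + smult c (hp (1 # s))"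
  using hp_Cons_diff[of c s 0] hp_Cons_diff[of 1 s 0]
  by (simp add: algebra_simps smult_diff_left smult_add_right)

section \<open>Refined Eulerian polynomials: all parameters 0 or 1\<close>

lemma hp_replicate_0: "n > 0 \<Longrightarrow> hp (replicate n 0) = [:0, 1:] * hp (replicate n 1)"
proof -
  assume n: "n > 0"
  \<comment> \<open>A shift of the index; the term m = 0 vanishes because n > 0.\<close>
  have "Abs_fps (\<lambda>m. \<Prod>r\<leftarrow>replicate n 0. real m + r) = fps_X * Abs_fps (\<lambda>m. \<Prod>r\<leftarrow>replicate n 1. real m + r)"
    using n by (intro fps_ext) (auto simp: fps_X_mult_nth prod_list_replicate map_replicate)
  hence "fps_of_poly (hp (replicate n 0)) = fps_of_poly ([:0, 1:] * hp (replicate n 1))"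
    by (simp add: fps_of_poly_hp fps_of_poly_mult fps_of_poly_pCons mult_ac)
  thus ?thesis by (simp only: fps_of_poly_eq_iff)
qed

text \<open>For k at most n this counts the permutations of n + 1 letters ending in k + 1 by
  descents; \<open>Eul_rec\<close> deletes the last letter.\<close>

abbreviation Eul :: "nat \<Rightarrow> nat \<Rightarrow> real poly" where
  "Eul n k \<equiv> hp (replicate k 1 @ replicate (n - k) 0)"

lemma Eul_diff:
  assumes "k \<le> n"
  shows "Eul (Suc n) (Suc k) - Eul (Suc n) k = [:1, -1:] * Eul n k"
proof -
  have "Eul (Suc n) (Suc k) - Eul (Suc n) k = hp (1 # (replicate k 1 @ replicate (n - k) 0)) - hp (0 # (replicate k 1 @ replicate (n - k) 0))"
    using assms by (intro arg_cong2[where f = "(-)"] hp_mset_cong) (auto simp: Suc_diff_le)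
  thus ?thesis unfolding hp_Cons_diff by simp
qed

lemma Eul_telescope:
  assumes "k \<le> l" "l \<le> Suc n"
  shows "Eul (Suc n) l - Eul (Suc n) k = [:1, -1:] * (\<Sum>j=k..<l. Eul n j)"
  using assms
proof (induction l rule: dec_induct)
  case (step m)
  have "Eul (Suc n) (Suc m) - Eul (Suc n) k = (Eul (Suc n) (Suc m) - Eul (Suc n) m) + (Eul (Suc n) m - Eul (Suc n) k)"
    by simp
  also have "\<dots> = [:1, -1:] * Eul n m + [:1, -1:] * (\<Sum>j=k..<m. Eul n j)"
    using step by (intro arg_cong2[where f = "(+)"] Eul_diff) auto
  also have "\<dots> = [:1, -1:] * (\<Sum>j=k..<Suc m. Eul n j)"
    using step.hyps by (simp add: distrib_left add.commute del: mult_pCons_left)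
  finally show ?case .
qed simp

lemma one_minus_X: "[:1, -1:] = 1 - [:0, 1 :: real:]"
  by (simp add: one_pCons)

text \<open>Telescoping over all indices gives 1 - x times the sum. Since E_0 = x E_(n+1) on this
  level, the same difference is (1 - x) E_(n+1), and 1 - x cancels.\<close>

lemma Eul_top: "Eul (Suc n) (Suc n) = (\<Sum>j<Suc n. Eul n j)"
proof -
  have "Eul (Suc n) 0 = [:0, 1:] * Eul (Suc n) (Suc n)"
    using hp_replicate_0[of "Suc n"] by simp
  hence "[:1, -1:] * Eul (Suc n) (Suc n) = [:1, -1:] * (\<Sum>j<Suc n. Eul n j)"
    using Eul_telescope[of 0 "Suc n" n] unfolding one_minus_X
    by (simp add: left_diff_distrib lessThan_atLeast0 del: mult_pCons_left)
  thus ?thesis by (simp del: mult_pCons_left)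
qed

lemma Eul_rec:
  assumes "k \<le> Suc n"
  shows "Eul (Suc n) k = [:0, 1:] * (\<Sum>j=k..<Suc n. Eul n j) + (\<Sum>j<k. Eul n j)"
proof -
  have "{..<Suc n} = {..<k} \<union> {k..<Suc n}" using assms by auto
  hence "Eul (Suc n) (Suc n) = (\<Sum>j<k. Eul n j) + (\<Sum>j=k..<Suc n. Eul n j)"
    unfolding Eul_top by (simp only: sum.union_disjoint finite_lessThan finite_atLeastLessThan ivl_disj_int)
  thus ?thesis using Eul_telescope[OF assms order_refl] unfolding one_minus_X
    by (simp add: algebra_simps del: mult_pCons_left)
qed

text \<open>Expanding one parameter after another by \<open>hp_Cons_affine\<close> turns
  \<open>hp rs\<close> into an iterated convex combination of Eulerian polynomials with the same
  n.\<close>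

lemma hp_induct [consumes 1, case_names Eul convex]:
  assumes "set rs \<subseteq> {0..1}"
    and Eul: "\<And>n k. k \<le> n \<Longrightarrow> P n (Eul n k)"
    and convex: "\<And>n f g t. P n f \<Longrightarrow> P n g \<Longrightarrow> 0 \<le> t \<Longrightarrow> t \<le> 1 \<Longrightarrow> P n (smult (1 - t) f + smult t g)"
  shows "P (length rs) (hp rs)"
proof -
  \<comment> \<open>Parameters already expanded are kept as i ones and k zeros; the next one joins
    either group.\<close>
  have "P (length rs + i + k) (hp (rs @ replicate i 1 @ replicate k 0))" for i k
    using assms(1)
  proof (induction rs arbitrary: i k)
    case Nil
    show ?case using Eul[of i "i + k"] by simp
  next
    case (Cons c rs)
    have "P (length rs + i + Suc k) (smult (1 - c) (hp (rs @ replicate i 1 @ replicate (Suc k) 0))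
        + smult c (hp (rs @ replicate (Suc i) 1 @ replicate k 0)))"
      using Cons.IH[of i "Suc k"] Cons.IH[of "Suc i" k] Cons.prems by (intro convex) auto
    also have "hp (rs @ replicate i 1 @ replicate (Suc k) 0) = hp (0 # rs @ replicate i 1 @ replicate k 0)"
      by (intro hp_mset_cong) auto
    also have "hp (rs @ replicate (Suc i) 1 @ replicate k 0) = hp (1 # rs @ replicate i 1 @ replicate k 0)"
      by (intro hp_mset_cong) auto
    finally show ?case by (simp flip: hp_Cons_affine)
  qed
  from this[of 0 0] show ?thesis by simp
qed

lemma coeff_Eul_nonneg: "k \<le> n \<Longrightarrow> coeff (Eul n k) i \<ge> 0"
proof (induction n arbitrary: k i)
  case (Suc n)
  have "coeff (\<Sum>j=k..<Suc n. Eul n j) i \<ge> 0" "coeff (\<Sum>j<k. Eul n j) i \<ge> 0" for i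
    using Suc by (auto simp: coeff_sum simp del: sum.op_ivl_Suc sum.lessThan_Suc intro!: sum_nonneg)
  thus ?case unfolding Eul_rec[OF Suc.prems] by (simp add: coeff_pCons del: sum.op_ivl_Suc split: nat.splits)
qed (simp add: coeff_1)

lemma coeff_hp_nonneg:
  assumes "set rs \<subseteq> {0..1}"
  shows "coeff (hp rs) i \<ge> 0"
proof -
  have "\<forall>i. coeff (hp rs) i \<ge> 0"
    using assms by (rule hp_induct[where P = "\<lambda>n f. \<forall>i. coeff f i \<ge> 0"]) (auto simp: coeff_Eul_nonneg)
  thus ?thesis ..
qed

lemma degree_Eul: "k \<le> n \<Longrightarrow> degree (Eul n k) \<le> n"
proof (induction n arbitrary: k)
  case (Suc n)
  have sum: "degree (\<Sum>j\<in>A. Eul n j) \<le> n" if "finite A" "A \<subseteq> {..n}" for A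
    using that(2) Suc.IH by (intro degree_sum_le[OF that(1)]) blast
  have "{k..<Suc n} \<subseteq> {..n}" by auto
  hence "degree ([:0, 1:] * (\<Sum>j=k..<Suc n. Eul n j)) \<le> Suc n"
    using sum[of "{k..<Suc n}"] by (intro order.trans[OF degree_mult_le]) (auto simp del: sum.op_ivl_Suc)
  moreover have "{..<k} \<subseteq> {..n}" using Suc.prems by auto
  hence "degree (\<Sum>j<k. Eul n j) \<le> Suc n"
    using sum[of "{..<k}"] by auto
  ultimately show ?case unfolding Eul_rec[OF Suc.prems]
    by (rule degree_add_le)
qed simp

section \<open>Reversal of coefficients\<close>

lemma coeff_Inv_poly: "coeff (Inv_poly n p) i = (if i \<le> n then coeff p (n - i) else 0)"
proof -
  have "coeff (Inv_poly n p) i = (\<Sum>k\<le>n. if n - k = i then coeff p k else 0)"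
    by (simp add: Inv_poly_def coeff_sum coeff_monom)
  also have "\<dots> = (\<Sum>k\<le>n. if k = n - i \<and> i \<le> n then coeff p k else 0)"
    by (intro sum.cong) auto
  also have "\<dots> = (if i \<le> n then coeff p (n - i) else 0)"
    by (cases "i \<le> n") auto
  finally show ?thesis .
qed

lemma Inv_poly_add: "Inv_poly n (p + q) = Inv_poly n p + Inv_poly n q"
  by (rule poly_eqI) (simp add: coeff_Inv_poly)

lemma Inv_poly_smult: "Inv_poly n (smult c p) = smult c (Inv_poly n p)"
  by (rule poly_eqI) (simp add: coeff_Inv_poly)

lemma Inv_poly_sum: "Inv_poly n (\<Sum>x\<in>A. f x) = (\<Sum>x\<in>A. Inv_poly n (f x))"
  by (rule poly_eqI) (simp add: coeff_Inv_poly coeff_sum)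

lemma Inv_poly_Suc:
  "degree p \<le> n \<Longrightarrow> Inv_poly (Suc n) p = [:0, 1:] * Inv_poly n p"
  by (rule poly_eqI) (auto simp: coeff_Inv_poly coeff_pCons coeff_eq_0 Suc_diff_le split: nat.splits)

lemma Inv_poly_Suc_pCons: "Inv_poly (Suc n) ([:0, 1:] * p) = Inv_poly n p"
  by (rule poly_eqI) (auto simp: coeff_Inv_poly coeff_pCons Suc_diff_le le_Suc_eq)

text \<open>Reversal moves the factor x from one block of \<open>Eul_rec\<close> to the other, and
  by induction it reverses the indices within each block.\<close>

lemma Inv_poly_Eul: "k \<le> n \<Longrightarrow> Inv_poly n (Eul n k) = Eul n (n - k)"
proof (induction n arbitrary: k)
  case 0
  thus ?case by (simp add: Inv_poly_def one_pCons monom_0)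
next
  case (Suc n)
  have deg: "degree (\<Sum>j<k. Eul n j) \<le> n"
    by (rule degree_sum_le) (use Suc.prems in \<open>simp_all add: degree_Eul\<close>)
  have "Inv_poly (Suc n) (Eul (Suc n) k) =
        (\<Sum>j=k..<Suc n. Eul n (n - j)) + [:0, 1:] * (\<Sum>j<k. Eul n (n - j))"
    unfolding Eul_rec[OF Suc.prems] Inv_poly_add Inv_poly_Suc_pCons Inv_poly_Suc[OF deg]
    unfolding Inv_poly_sum
    using Suc by (intro arg_cong2[where f = "(+)"] arg_cong2[where f = "(*)"] sum.cong refl) auto
  also have "(\<Sum>j=k..<Suc n. Eul n (n - j)) = (\<Sum>j<Suc n - k. Eul n j)"
    by (rule sum.reindex_bij_witness[of _ "\<lambda>j. n - j" "\<lambda>j. n - j"]) auto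
  also have "(\<Sum>j<k. Eul n (n - j)) = (\<Sum>j=Suc n - k..<Suc n. Eul n j)"
    using Suc.prems by (intro sum.reindex_bij_witness[of _ "\<lambda>j. n - j" "\<lambda>j. n - j"]) auto
  finally show ?case using Eul_rec[of "Suc n - k" n] by (simp add: add.commute)
qed

text \<open>Expand as in \<open>hp_induct\<close>. Passing from c to 1 - c exchanges the weights of
  0 and 1, and on the Eulerian polynomials reversal exchanges zeros and ones.\<close>

lemma Inv_poly_hp: "Inv_poly (length rs) (hp rs) = hp (map (\<lambda>r. 1 - r) rs)"
proof -
  have "Inv_poly (length rs + i + k) (hp (rs @ replicate i 1 @ replicate k 0)) =
     hp (map (\<lambda>r. 1 - r) rs @ replicate k 1 @ replicate i 0)" for i k
  proof (induction rs arbitrary: i k)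
    case Nil
    show ?case using Inv_poly_Eul[of i "i + k"] by simp
  next
    case (Cons c rs)
    have "hp ((c # rs) @ replicate i 1 @ replicate k 0) =
      smult (1 - c) (hp (rs @ replicate i 1 @ replicate (Suc k) 0))
        + smult c (hp (rs @ replicate (Suc i) 1 @ replicate k 0))"
      by (subst append_Cons, subst hp_Cons_affine) (intro arg_cong2[where f = "(+)"] arg_cong2[where f = smult] refl hp_mset_cong, auto)
    moreover have "hp (map (\<lambda>r. 1 - r) (c # rs) @ replicate k 1 @ replicate i 0) =
      smult (1 - (1 - c)) (hp (map (\<lambda>r. 1 - r) rs @ replicate k 1 @ replicate (Suc i) 0))
        + smult (1 - c) (hp (map (\<lambda>r. 1 - r) rs @ replicate (Suc k) 1 @ replicate i 0))"
      by (subst list.map, subst append_Cons, subst hp_Cons_affine) (intro arg_cong2[where f = "(+)"] arg_cong2[where f = smult] refl hp_mset_cong, auto)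
    ultimately show ?case using Cons.IH[of i "Suc k"] Cons.IH[of "Suc i" k]
      by (simp add: Inv_poly_add Inv_poly_smult add.commute)
  qed
  from this[of 0 0] show ?thesis by simp
qed

section \<open>Arguments at a point of the upper half-plane\<close>

abbreviation cev :: "real poly \<Rightarrow> complex \<Rightarrow> complex" where
  "cev p z \<equiv> poly (map_poly complex_of_real p) z"

lemma cev_pCons [simp]: "cev (pCons c p) z = of_real c + z * cev p z"
  by (cases "c = 0 \<and> p = 0") (auto simp: map_poly_pCons)

lemma cev_add [simp]: "cev (p + q) z = cev p z + cev q z"
  by (induction p q rule: poly_induct2) (simp_all add: algebra_simps)

lemma cev_smult [simp]: "cev (smult c p) z = of_real c * cev p z"
  by (induction p) (simp_all add: algebra_simps)

lemma cev_minus [simp]: "cev (- p) z = - cev p z"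
  using cev_smult[of "-1" p z] by simp

lemma cev_diff [simp]: "cev (p - q) z = cev p z - cev q z"
  using cev_add[of p "- q" z] by simp

lemma cev_mult [simp]: "cev (p * q) z = cev p z * cev q z"
  by (induction p) (simp_all add: algebra_simps)

lemma cev_1 [simp]: "cev 1 z = 1"
  by (simp add: one_pCons)

lemma cev_sum [simp]: "cev (\<Sum>x\<in>A. f x) z = (\<Sum>x\<in>A. cev (f x) z)"
  by (induction A rule: infinite_finite_induct) auto

lemma cev_cnj: "cev p (cnj z) = cnj (cev p z)"
  by (induction p) auto

text \<open>This is |u| |v| sin (arg u - arg v), real-bilinear and alternating. For nonzero u and v
  it is nonnegative iff u is ahead of v by an angle in [0, pi].\<close>

definition wedge :: "complex \<Rightarrow> complex \<Rightarrow> real" where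
  "wedge u v = Im (u * cnj v)"

lemma wedge_add_left: "wedge (u + v) w = wedge u w + wedge v w"
  and wedge_add_right: "wedge w (u + v) = wedge w u + wedge w v"
  and wedge_diff_left: "wedge (u - v) w = wedge u w - wedge v w"
  and wedge_diff_right: "wedge w (u - v) = wedge w u - wedge w v"
  and wedge_scale_left: "wedge (of_real c * u) w = c * wedge u w"
  and wedge_scale_right: "wedge w (of_real c * u) = c * wedge w u"
  and wedge_0_left [simp]: "wedge 0 w = 0"
  and wedge_0_right [simp]: "wedge w 0 = 0"
  and wedge_self [simp]: "wedge w w = 0"
  by (simp_all add: wedge_def algebra_simps)

lemma wedge_sum_left: "wedge (\<Sum>x\<in>A. f x) w = (\<Sum>x\<in>A. wedge (f x) w)"
  by (induction A rule: infinite_finite_induct) (auto simp: wedge_add_left)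

lemma wedge_sum_right: "wedge w (\<Sum>x\<in>A. f x) = (\<Sum>x\<in>A. wedge w (f x))"
  by (induction A rule: infinite_finite_induct) (auto simp: wedge_add_right)

lemma wedge_swap: "wedge u v = - wedge v u"
  by (simp add: wedge_def)

lemma wedge_mult_mult: "wedge (z * u) (z * v) = (cmod z)\<^sup>2 * wedge u v"
  by (simp add: wedge_def cmod_power2) algebra

lemma wedge_mult_self: "wedge (z * u) u = Im z * (cmod u)\<^sup>2"
  by (simp add: wedge_def cmod_power2) algebra

lemma wedge_pluecker: "wedge u w * wedge v x = wedge u v * wedge w x + wedge u x * wedge v w"
  by (simp add: wedge_def) algebra

text \<open>For \<open>Im z > 0\<close> and \<open>e \<noteq> 0\<close>: the nonzero points of the closed convex cone spanned by \<open>e\<close> and \<open>z * e\<close>.\<close>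

definition arc :: "complex \<Rightarrow> complex \<Rightarrow> complex \<Rightarrow> bool" where
  "arc z e u \<longleftrightarrow> u \<noteq> 0 \<and> wedge u e \<ge> 0 \<and> wedge (z * e) u \<ge> 0"

text \<open>Cramer's rule in the real basis \<open>e\<close>, \<open>z * e\<close>, whose
  determinant is Im z |e|^2 > 0.\<close>

lemma arc_coords:
  assumes "arc z e u" "Im z > 0" "e \<noteq> 0"
  obtains \<alpha> \<beta> where "\<alpha> \<ge> 0" "\<beta> \<ge> 0" "\<alpha> + \<beta> > 0" "u = e * (of_real \<alpha> + of_real \<beta> * z)"
proof -
  define d where "d = wedge (z * e) e"
  have d: "d > 0" using assms by (simp add: d_def wedge_mult_self)
  have "of_real d * u = e * (of_real (wedge (z * e) u) + of_real (wedge u e) * z)"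
    unfolding d_def wedge_def complex_eq_iff by (simp; algebra)
  hence u: "u = e * (of_real (wedge (z * e) u / d) + of_real (wedge u e / d) * z)"
    using d by (simp add: field_simps)
  have nn: "wedge (z * e) u / d \<ge> 0" "wedge u e / d \<ge> 0"
    using assms d by (auto simp: arc_def)
  have "wedge (z * e) u / d + wedge u e / d \<noteq> 0"
  proof
    assume "wedge (z * e) u / d + wedge u e / d = 0"
    with nn have "wedge (z * e) u / d = 0" "wedge u e / d = 0" by linarith+
    with u have "u = 0" by (metis add.right_neutral mult_zero_left mult_zero_right of_real_0)
    with assms show False by (simp add: arc_def)
  qed
  with u nn that[of "wedge (z * e) u / d" "wedge u e / d"] show thesis by simp
qed

text \<open>A linear functional that is positive on the whole cone, namely a positive multiple of
  \<alpha> + \<beta> in the coordinates above. Hence elements of the cone cannot cancel in a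
  sum.\<close>

lemma arc_weight_pos:
  assumes "arc z e u" "Im z > 0" "e \<noteq> 0"
  shows "wedge u e + wedge (z * e) u > 0"
proof -
  obtain \<alpha> \<beta> where *: "\<alpha> \<ge> 0" "\<beta> \<ge> 0" "\<alpha> + \<beta> > 0" "u = e * (of_real \<alpha> + of_real \<beta> * z)"
    using arc_coords[OF assms] .
  have "wedge u e + wedge (z * e) u = Im z * (cmod e)\<^sup>2 * (\<alpha> + \<beta>)"
    unfolding *(4) by (simp add: wedge_def cmod_power2) algebra
  thus ?thesis using * assms by simp
qed

lemma arc_add:
  assumes "arc z e u" "arc z e v" "Im z > 0" "e \<noteq> 0"
  shows "arc z e (u + v)"
proof -
  have "wedge (u + v) e + wedge (z * e) (u + v) > 0"
    using arc_weight_pos[OF assms(1,3,4)] arc_weight_pos[OF assms(2,3,4)]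
    by (simp add: wedge_add_left wedge_add_right)
  hence "u + v \<noteq> 0" by auto
  thus ?thesis using assms(1,2) by (auto simp: arc_def wedge_add_left wedge_add_right)
qed

lemma arc_scale: "arc z e u \<Longrightarrow> c > 0 \<Longrightarrow> arc z e (of_real c * u)"
  by (auto simp: arc_def wedge_scale_left wedge_scale_right)

lemma arc_sum:
  assumes "finite A" "A \<noteq> {}" "\<And>x. x \<in> A \<Longrightarrow> arc z e (f x)" "Im z > 0" "e \<noteq> 0"
  shows "arc z e (\<Sum>x\<in>A. f x)"
  using assms by (induction A rule: finite_ne_induct) (auto intro: arc_add)

lemma arc_convex:
  assumes "arc z e u" "arc z e v" "Im z > 0" "e \<noteq> 0" "0 \<le> t" "t \<le> 1"
  shows "arc z e (of_real (1 - t) * u + of_real t * v)"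
proof (cases "t = 0 \<or> t = 1")
  case False
  with assms show ?thesis by (intro arc_add arc_scale) auto
qed (use assms in auto)

text \<open>The order by argument is transitive only inside a pointed cone. Two Pluecker relations,
  with \<open>e\<close> and with \<open>z * e\<close>, are added so that the positive weight of
  \<open>v\<close> can be divided out.\<close>

lemma arc_trans:
  assumes "arc z e u" "arc z e v" "arc z e w" "Im z > 0" "e \<noteq> 0"
    and "wedge u v \<ge> 0" "wedge v w \<ge> 0"
  shows "wedge u w \<ge> 0"
proof -
  have "wedge u w * wedge v e \<ge> 0"
    unfolding wedge_pluecker[of u w v e] using assms by (auto simp: arc_def)
  moreover have "wedge u w * wedge (z * e) v = wedge u v * wedge (z * e) w + wedge (z * e) u * wedge v w"
    using wedge_pluecker[of u w v "z * e"] wedge_swap[of _ "z * e"] by simp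
  hence "wedge u w * wedge (z * e) v \<ge> 0" using assms by (auto simp: arc_def)
  ultimately have "wedge u w * (wedge v e + wedge (z * e) v) \<ge> 0"
    by (simp add: distrib_left)
  with arc_weight_pos[OF assms(2,4,5)] show ?thesis by (simp add: zero_le_mult_iff)
qed

text \<open>The cone has opening angle arg z, so \<open>u\<close> is ahead of \<open>v\<close> by at
  most arg z and cannot pass \<open>z * v\<close>.\<close>

lemma arc_turn:
  assumes "arc z e u" "arc z e v" "Im z > 0" "e \<noteq> 0" "wedge u v \<ge> 0"
  shows "wedge (z * v) u \<ge> 0"
proof -
  obtain a b where u: "a \<ge> 0" "b \<ge> 0" "a + b > 0" "u = e * (of_real a + of_real b * z)"
    using arc_coords[OF assms(1,3,4)] .
  obtain c d where v: "c \<ge> 0" "d \<ge> 0" "c + d > 0" "v = e * (of_real c + of_real d * z)"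
    using arc_coords[OF assms(2,3,4)] .
  have "wedge u v = Im z * (cmod e)\<^sup>2 * (b * c - a * d)"
    unfolding u(4) v(4) by (simp add: wedge_def cmod_power2) algebra
  moreover have "Im z * (cmod e)\<^sup>2 > 0" using assms by simp
  ultimately have bc: "b * c \<ge> a * d" using assms(5) by (simp add: zero_le_mult_iff)
  have eq: "wedge (z * v) u = Im z * (cmod e)\<^sup>2 * (a * c + b * d * (cmod z)\<^sup>2 + 2 * Re z * (a * d))"
    unfolding u(4) v(4) by (simp add: wedge_def cmod_power2) algebra
  have "a * c + b * d * (cmod z)\<^sup>2 + 2 * Re z * (a * d) \<ge> 0"
  proof (cases "b = 0")
    case True
    with bc have "a * d \<le> 0" by simp
    with u v have "a * d = 0" by (intro order_antisym) auto
    with True u v show ?thesis by simp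
  next
    case False
    \<comment> \<open>Re z may be negative. After multiplication by b, replacing b * c by the
      smaller a * d leaves exactly d |a + b z|^2.\<close>
    have "0 \<le> d * (cmod (of_real a + of_real b * z))\<^sup>2" using v by simp
    also have "\<dots> = a * (a * d) + b * (b * d * (cmod z)\<^sup>2 + 2 * Re z * (a * d))"
      by (simp add: cmod_power2) algebra
    also have "\<dots> \<le> a * (b * c) + b * (b * d * (cmod z)\<^sup>2 + 2 * Re z * (a * d))"
      using bc u by (intro add_right_mono mult_left_mono)
    also have "\<dots> = b * (a * c + b * d * (cmod z)\<^sup>2 + 2 * Re z * (a * d))"
      by algebra
    finally show ?thesis using False u by (simp add: zero_le_mult_iff)
  qed
  thus ?thesis unfolding eq using assms by simp
qed

section \<open>Arguments of the Eulerian polynomials and of \<open>hp\<close>\<close>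

lemma Eul_cev_rec:
  assumes "k \<le> Suc n"
  shows "cev (Eul (Suc n) k) z = z * (\<Sum>j=k..<Suc n. cev (Eul n j) z) + (\<Sum>j<k. cev (Eul n j) z)"
  unfolding Eul_rec[OF assms] by (simp del: sum.op_ivl_Suc)

text \<open>Arguments decrease with the index, within a window of width arg z. Both bounds go
  through the induction together, since each needs both bounds of the previous level.\<close>

lemma Eul_window:
  assumes "Im z > 0" "i \<le> j" "j \<le> n"
  shows "wedge (cev (Eul n i) z) (cev (Eul n j) z) \<ge> 0 \<and>
         wedge (z * cev (Eul n j) z) (cev (Eul n i) z) \<ge> 0"
  using assms(2,3)
proof (induction n arbitrary: i j)
  case 0
  thus ?case using assms by (simp add: wedge_def)
next
  case (Suc n)
  define v where "v j = cev (Eul n j) z" for j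
  have v1: "wedge (v i) (v j) \<ge> 0" if "i \<le> j" "j \<le> n" for i j
    using Suc.IH[OF that] by (simp add: v_def)
  have v2: "wedge (z * v j) (v i) \<ge> 0" if "i \<le> j" "j \<le> n" for i j
    using Suc.IH[OF that] by (simp add: v_def)
  \<comment> \<open>By the recursion the values at i and j are w + z S2 and w + S2 with a common w =
    S1 + z S3: only the factor of the middle block changes.\<close>
  define S1 S2 S3 where "S1 = (\<Sum>j<i. v j)" and "S2 = (\<Sum>k=i..<j. v k)" and "S3 = (\<Sum>j=j..<Suc n. v j)"
  have 12: "wedge S1 S2 \<ge> 0" and 23: "wedge S2 S3 \<ge> 0" and 21: "wedge (z * S2) S1 \<ge> 0" and 32: "wedge (z * S3) S2 \<ge> 0"
    unfolding S1_def S2_def S3_def wedge_sum_left wedge_sum_right sum_distrib_left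
    using Suc.prems by (auto intro!: sum_nonneg v1 v2 simp del: sum.op_ivl_Suc)
  define w where "w = S1 + z * S3"
  have "(\<Sum>k=i..<Suc n. v k) = S2 + S3"
    unfolding S2_def S3_def using Suc.prems by (subst sum.atLeastLessThan_concat) auto
  hence ui: "cev (Eul (Suc n) i) z = w + z * S2"
    using Eul_cev_rec[of i n z] Suc.prems by (simp add: w_def S1_def v_def algebra_simps del: sum.op_ivl_Suc)
  have "(\<Sum>k<j. v k) = S1 + S2"
    unfolding S1_def S2_def using Suc.prems by (simp add: lessThan_atLeast0 sum.atLeastLessThan_concat)
  hence uj: "cev (Eul (Suc n) j) z = w + S2"
    using Eul_cev_rec[of j n z] Suc.prems by (simp add: w_def S3_def v_def algebra_simps del: sum.op_ivl_Suc)
  have w2: "wedge w S2 \<ge> 0"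
    using 12 32 by (simp add: w_def wedge_add_left)
  have 2: "wedge (z * S2) w \<ge> 0"
    using 21 23 by (simp add: w_def wedge_add_right wedge_mult_mult)
  have "wedge (w + z * S2) (w + S2) = wedge w S2 + wedge (z * S2) w + Im z * (cmod S2)\<^sup>2"
    by (simp add: wedge_add_left wedge_add_right wedge_mult_self)
  moreover have "wedge (z * (w + S2)) (w + z * S2) = Im z * (cmod w)\<^sup>2 + (cmod z)\<^sup>2 * wedge w S2 + wedge (z * S2) w"
    by (simp add: wedge_add_left wedge_add_right wedge_mult_self distrib_left wedge_mult_mult)
  ultimately show ?case unfolding ui uj using w2 2 assms by simp
qed

text \<open>Nonempty sums of values of the previous level lie in a pointed cone and do not vanish.
  If the recursion gave 0, then S = - z T; as S is not behind T, this forces S = T = 0, although one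
  of the two blocks is nonempty.\<close>

lemma Eul_nonzero:
  assumes "Im z > 0" "k \<le> n"
  shows "cev (Eul n k) z \<noteq> 0"
  using assms(2)
proof (induction n arbitrary: k)
  case (Suc n)
  let ?v = "\<lambda>j. cev (Eul n j) z"
  have sum: "(\<Sum>j\<in>A. ?v j) \<noteq> 0" if "A \<subseteq> {..n}" "A \<noteq> {}" for A
  proof -
    have "arc z (?v n) (\<Sum>j\<in>A. ?v j)"
    proof (rule arc_sum)
      show "finite A" using that finite_subset by blast
      show "arc z (?v n) (?v j)" if "j \<in> A" for j
        using that \<open>A \<subseteq> {..n}\<close> Suc.IH[of j] Eul_window[OF assms(1), of j n n] by (auto simp: arc_def)
      show "?v n \<noteq> 0" by (rule Suc.IH) simp
    qed (use assms that in auto)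
    thus ?thesis by (simp add: arc_def)
  qed
  define S T where "S = (\<Sum>j<k. ?v j)" and "T = (\<Sum>j=k..<Suc n. ?v j)"
  have ST: "wedge S T \<ge> 0"
    unfolding S_def T_def wedge_sum_left wedge_sum_right
    using Suc.prems by (auto intro!: sum_nonneg conjunct1[OF Eul_window] assms simp del: sum.op_ivl_Suc)
  show ?case
  proof
    assume "cev (Eul (Suc n) k) z = 0"
    hence "S = - (z * T)"
      unfolding Eul_cev_rec[OF Suc.prems] S_def T_def by (simp add: eq_neg_iff_add_eq_0 add.commute)
    hence "wedge S T = - (Im z * (cmod T)\<^sup>2)"
      using wedge_mult_self[of z T] by (simp add: wedge_def)
    hence "Im z * (cmod T)\<^sup>2 \<le> 0" using ST by simp
    with assms(1) have T: "T = 0" by (simp add: mult_le_0_iff)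
    with \<open>S = - (z * T)\<close> have "S = 0" by simp
    show False
    proof (cases "k = 0")
      case True
      with T sum[of "{k..<Suc n}"] show False unfolding T_def by force
    next
      case False
      with \<open>S = 0\<close> sum[of "{..<k}"] Suc.prems show False unfolding S_def by force
    qed
  qed
qed simp

text \<open>\<open>Eul n n\<close> has the least argument among the \<open>Eul n k\<close> and spans
  one edge of the cone; for n > 0 the other edge is spanned by \<open>Eul n 0\<close>.\<close>

lemma arc_hp:
  assumes "Im z > 0" "set rs \<subseteq> {0..1}"
  shows "arc z (cev (Eul (length rs) (length rs)) z) (cev (hp rs) z)"
proof (rule hp_induct[where P = "\<lambda>n f. arc z (cev (Eul n n) z) (cev f z)"])
  show "set rs \<subseteq> {0..1}" by fact
next
  fix n k :: nat assume "k \<le> n"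
  thus "arc z (cev (Eul n n) z) (cev (Eul n k) z)"
    unfolding arc_def using Eul_window[OF assms(1), of k n n] Eul_nonzero[OF assms(1), of k n] by blast
next
  fix n and f g :: "real poly" and t :: real
  assume "arc z (cev (Eul n n) z) (cev f z)" "arc z (cev (Eul n n) z) (cev g z)" "0 \<le> t" "t \<le> 1"
  from arc_convex[OF this(1,2) assms(1) _ this(3,4)] Eul_nonzero[OF assms(1), of n n]
  show "arc z (cev (Eul n n) z) (cev (smult (1 - t) f + smult t g) z)" by simp
qed

text \<open>Expanding the other parameters into zeros and ones reduces this, by bilinearity, to
  \<open>Eul_window\<close>.\<close>

lemma wedge_hp_01:
  assumes "Im z > 0" "set rs \<subseteq> {0..1}"
  shows "wedge (cev (hp (0 # rs)) z) (cev (hp (1 # rs)) z) \<ge> 0"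
proof -
  have "wedge (cev (hp (rs @ replicate i 1 @ replicate (k - i) 0)) z)
              (cev (hp (rs @ replicate j 1 @ replicate (k - j) 0)) z) \<ge> 0" if "i \<le> j" "j \<le> k" for i j k
    using assms(2) that
  proof (induction rs arbitrary: i j k)
    case Nil
    thus ?case using Eul_window[OF assms(1), of i j k] by simp
  next
    case (Cons c rs)
    define X where "X k i = cev (hp (rs @ replicate i 1 @ replicate (k - i) 0)) z" for k i
    have split: "cev (hp ((c # rs) @ replicate i 1 @ replicate (k - i) 0)) z =
       of_real (1 - c) * X (Suc k) i + of_real c * X (Suc k) (Suc i)" if "i \<le> k" for i
    proof -
      have "hp ((c # rs) @ replicate i 1 @ replicate (k - i) 0) =
         smult (1 - c) (hp (rs @ replicate i 1 @ replicate (Suc k - i) 0))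
         + smult c (hp (rs @ replicate (Suc i) 1 @ replicate (Suc k - Suc i) 0))"
        using that by (subst append_Cons, subst hp_Cons_affine)
          (intro arg_cong2[where f = "(+)"] arg_cong2[where f = smult] refl hp_mset_cong, auto simp: Suc_diff_le)
      thus ?thesis by (simp only: X_def cev_add cev_smult)
    qed
    show ?case
    \<comment> \<open>For i = j the pair (Suc i, j) would be in the wrong order, but then both
      arguments of \<open>wedge\<close> coincide.\<close>
    proof (cases "i = j")
      case False
      hence "wedge (X (Suc k) a) (X (Suc k) b) \<ge> 0" if "a \<in> {i, Suc i}" "b \<in> {j, Suc j}" for a b
        using that Cons.prems unfolding X_def by (intro Cons.IH) auto
      hence "wedge (X (Suc k) i) (X (Suc k) j) \<ge> 0" "wedge (X (Suc k) i) (X (Suc k) (Suc j)) \<ge> 0"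
        "wedge (X (Suc k) (Suc i)) (X (Suc k) j) \<ge> 0" "wedge (X (Suc k) (Suc i)) (X (Suc k) (Suc j)) \<ge> 0"
        by blast+
      moreover have "0 \<le> c" "0 \<le> 1 - c" using Cons.prems by auto
      ultimately show ?thesis
        unfolding split[OF order.trans[OF Cons.prems(2,3)]] split[OF Cons.prems(3)]
          wedge_add_left wedge_add_right wedge_scale_left wedge_scale_right
        by (intro add_nonneg_nonneg mult_nonneg_nonneg)
    qed auto
  qed
  from this[of 0 1 1] have "wedge (cev (hp (rs @ [0])) z) (cev (hp (rs @ [1])) z) \<ge> 0" by simp
  moreover have "hp (rs @ [0]) = hp (0 # rs)" "hp (rs @ [1]) = hp (1 # rs)"
    by (rule hp_mset_cong; simp)+
  ultimately show ?thesis by simp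
qed

lemma wedge_hp_Cons:
  assumes "Im z > 0" "set rs \<subseteq> {0..1}" "c \<le> d"
  shows "wedge (cev (hp (c # rs)) z) (cev (hp (d # rs)) z) \<ge> 0"
proof -
  \<comment> \<open>The factor d - c is the determinant of the weights (1 - c, c) and (1 - d,
    d).\<close>
  have "wedge (cev (hp (c # rs)) z) (cev (hp (d # rs)) z) =
        (d - c) * wedge (cev (hp (0 # rs)) z) (cev (hp (1 # rs)) z)"
    unfolding hp_Cons_affine[of c] hp_Cons_affine[of d]
    using wedge_swap[of "cev (hp (1 # rs)) z" "cev (hp (0 # rs)) z"]
    by (simp only: cev_add cev_smult wedge_add_left wedge_add_right wedge_scale_left wedge_scale_right)
       (simp add: algebra_simps)
  thus ?thesis using wedge_hp_01[OF assms(1,2)] assms(3) by simp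
qed

text \<open>Parameters are raised one at a time, \<open>us\<close> being those already raised;
  \<open>arc_trans\<close> chains the steps because all intermediate values lie in one cone.\<close>

lemma hp_wedge_mono:
  assumes "Im z > 0" "list_all2 (\<le>) rs ss" "set rs \<subseteq> {0..1}" "set ss \<subseteq> {0..1}"
  shows "wedge (cev (hp rs) z) (cev (hp ss) z) \<ge> 0"
proof -
  have "wedge (cev (hp (us @ rs)) z) (cev (hp (us @ ss)) z) \<ge> 0" if "set us \<subseteq> {0..1}" for us
    using assms(2-4) that
  proof (induction rs ss arbitrary: us rule: list_all2_induct)
    case (Cons r rs s ss)
    have len: "length rs = length ss" using Cons.hyps by (simp add: list_all2_lengthD)
    let ?n = "length (us @ s # ss)"
    show ?case
    proof (rule arc_trans[where z = z and e = "cev (Eul ?n ?n) z" and v = "cev (hp (us @ s # rs)) z"])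
      show "arc z (cev (Eul ?n ?n) z) (cev (hp (us @ s # rs)) z)"
        using arc_hp[OF assms(1), of "us @ s # rs"] Cons.prems len by simp
      show "arc z (cev (Eul ?n ?n) z) (cev (hp (us @ r # rs)) z)"
        using arc_hp[OF assms(1), of "us @ r # rs"] Cons.prems len by simp
      show "arc z (cev (Eul ?n ?n) z) (cev (hp (us @ s # ss)) z)"
        using arc_hp[OF assms(1), of "us @ s # ss"] Cons.prems by simp
      show "wedge (cev (hp (us @ r # rs)) z) (cev (hp (us @ s # rs)) z) \<ge> 0"
      proof -
        have "hp (us @ c # rs) = hp (c # us @ rs)" for c
          by (rule hp_mset_cong) simp
        thus ?thesis using wedge_hp_Cons[OF assms(1), of "us @ rs" r s] Cons by auto
      qed
      show "wedge (cev (hp (us @ s # rs)) z) (cev (hp (us @ s # ss)) z) \<ge> 0"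
        using Cons.IH[of "us @ [s]"] Cons.prems by simp
      show "cev (Eul ?n ?n) z \<noteq> 0" by (rule Eul_nonzero[OF assms(1) order_refl])
    qed (fact assms(1))
  qed simp
  from this[of "[]"] show ?thesis by simp
qed

lemma hp_wedge_turn:
  assumes "Im z > 0" "list_all2 (\<le>) rs ss" "set rs \<subseteq> {0..1}" "set ss \<subseteq> {0..1}"
  shows "wedge (z * cev (hp ss) z) (cev (hp rs) z) \<ge> 0"
proof -
  have "length rs = length ss" using assms by (simp add: list_all2_lengthD)
  thus ?thesis
    using arc_turn[OF arc_hp[OF assms(1,3)] _ assms(1) Eul_nonzero[OF assms(1)] hp_wedge_mono[OF assms]]
      arc_hp[OF assms(1,4)] by simp
qed

section \<open>Paths of parameters and the symmetric decomposition\<close>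

text \<open>The quotient of \<open>hp s - hp t\<close> by x - 1 when \<open>s\<close> is changed
  into \<open>t\<close> from left to right. Each term omits the parameter that is being
  changed.\<close>

definition hp_path :: "real list \<Rightarrow> real list \<Rightarrow> real poly" where
  "hp_path s t = (\<Sum>i<length s. smult (t ! i - s ! i) (hp (take i t @ drop (Suc i) s)))"

lemma hp_diff_path:
  assumes "length s = length t"
  shows "hp s - hp t = [:-1, 1:] * hp_path s t"
proof -
  define X where "X i = hp (take i t @ drop i s)" for i
  have "X i - X (Suc i) = [:-1, 1:] * smult (t ! i - s ! i) (hp (take i t @ drop (Suc i) s))"
    if "i < length s" for i
  proof -
    let ?u = "take i t @ drop (Suc i) s"
    have "X i = hp (s ! i # ?u)" "X (Suc i) = hp (t ! i # ?u)"
      using that assms unfolding X_def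
      by (intro hp_mset_cong; simp flip: Cons_nth_drop_Suc add: take_Suc_conv_app_nth)+
    moreover have "smult (s ! i - t ! i) ([:1, -1:] * f) = [:-1, 1:] * smult (t ! i - s ! i) f" for f
      by (simp add: algebra_simps smult_diff_left smult_add_right)
    ultimately show ?thesis using hp_Cons_diff[of "s ! i" ?u "t ! i"] by simp
  qed
  hence "(\<Sum>i<length s. X i - X (Suc i)) = [:-1, 1:] * hp_path s t"
    unfolding hp_path_def sum_distrib_left by (intro sum.cong) auto
  moreover have "(\<Sum>i<length s. X i - X (Suc i)) = X 0 - X (length s)"
    by (rule sum_lessThan_telescope')
  ultimately show ?thesis using assms by (simp add: X_def)
qed

lemma coeff_hp_path_nonneg:
  assumes "list_all2 (\<le>) s t" "set s \<subseteq> {0..1}" "set t \<subseteq> {0..1}"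
  shows "coeff (hp_path s t) i \<ge> 0"
proof -
  have "coeff (hp (take i t @ drop (Suc i) s)) j \<ge> 0" for i j
    using assms(2,3) set_take_subset[of i t] set_drop_subset[of "Suc i" s]
    by (intro coeff_hp_nonneg) auto
  thus ?thesis using assms(1) unfolding hp_path_def
    by (auto simp: coeff_sum list_all2_conv_all_nth intro!: sum_nonneg)
qed

text \<open>All pairs of terms can be compared entry by entry. Omitting a position shifts the later
  entries by one, so entries at neighbouring positions meet; this is where sortedness
  enters.\<close>

lemma wedge_hp_path:
  assumes z: "Im z > 0" and le: "list_all2 (\<le>) r s"
    and r: "set r \<subseteq> {0..1}" "sorted r" and s: "set s \<subseteq> {0..1}" "sorted s"
  defines "a \<equiv> [:0, 1:] * hp_path s (replicate (length s) 1) + hp_path (replicate (length r) 0) r"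
    and "b \<equiv> hp_path r s"
  shows "wedge (cev a z) (cev b z) \<ge> 0"
proof -
  define n where "n = length r"
  have len: "length r = n" "length s = n" using le by (simp_all add: n_def list_all2_lengthD)
  have rs: "r ! i \<le> s ! i" if "i < n" for i
    using le that len by (auto simp: list_all2_conv_all_nth)
  have rS: "r ! i \<le> r ! Suc i" and sS: "s ! i \<le> s ! Suc i" if "Suc i < n" for i
    using r s that len by (auto simp: sorted_iff_nth_mono)
  have in01: "0 \<le> r ! i" "r ! i \<le> 1" "0 \<le> s ! i" "s ! i \<le> 1" if "i < n" for i
    using r s that len nth_mem[of i r] nth_mem[of i s] by fastforce+
  have sub: "set (take i t @ drop j u) \<subseteq> {0..1}" if "set t \<subseteq> {0..1}" "set u \<subseteq> {0..1}" for i j and t u :: "real list"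
    using that set_take_subset[of i t] set_drop_subset[of j u] by auto
  have 01: "set (replicate m x) \<subseteq> {0..1}" if "x \<in> {0..1}" for m and x :: real
    using that by (cases m) auto
  have A: "wedge (cev (hp (take i r @ drop (Suc i) (replicate n 0))) z) (cev (hp (take j s @ drop (Suc j) r)) z) \<ge> 0"
    if "i < n" "j < n" for i j
  proof (rule hp_wedge_mono[OF z])
    show "list_all2 (\<le>) (take i r @ drop (Suc i) (replicate n 0)) (take j s @ drop (Suc j) r)"
      using that len rs rS order.trans[OF rS rs] in01 by (auto simp: list_all2_conv_all_nth nth_append)
  qed (intro sub 01 r s; simp)+
  have B: "wedge (z * cev (hp (take i (replicate n 1) @ drop (Suc i) s)) z) (cev (hp (take j s @ drop (Suc j) r)) z) \<ge> 0"
    if "i < n" "j < n" for i j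
  proof (rule hp_wedge_turn[OF z])
    show "list_all2 (\<le>) (take j s @ drop (Suc j) r) (take i (replicate n 1) @ drop (Suc i) s)"
      using that len rs sS in01 by (auto simp: list_all2_conv_all_nth nth_append)
  qed (intro sub 01 r s; simp)+
  have ca: "cev a z = (\<Sum>i<n. of_real (1 - s ! i) * (z * cev (hp (take i (replicate n 1) @ drop (Suc i) s)) z))
         + (\<Sum>i<n. of_real (r ! i) * cev (hp (take i r @ drop (Suc i) (replicate n 0))) z)"
    unfolding a_def hp_path_def by (auto simp: len sum_distrib_left mult_ac intro!: arg_cong2[where f = "(+)"] sum.cong)
  have cb: "cev b z = (\<Sum>j<n. of_real (s ! j - r ! j) * cev (hp (take j s @ drop (Suc j) r)) z)"
    unfolding b_def hp_path_def by (simp add: len)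
  show ?thesis
    unfolding ca cb wedge_add_left wedge_sum_left wedge_sum_right wedge_scale_left wedge_scale_right
    using A B rs in01 by (intro add_nonneg_nonneg sum_nonneg mult_nonneg_nonneg) auto
qed

text \<open>The path runs from \<open>s\<close> up to all ones, jumps to all zeros by x h(1,...,1) =
  h(0,...,0), and continues up to \<open>r\<close>.\<close>

lemma hp_turn_diff_path:
  assumes "length r = length s" "s \<noteq> []"
  shows "[:0, 1:] * hp s - hp r =
    [:-1, 1:] * ([:0, 1:] * hp_path s (replicate (length s) 1) + hp_path (replicate (length r) 0) r)"
proof -
  have "[:0, 1:] * hp s - hp r = [:0, 1:] * (hp s - hp (replicate (length s) 1)) +
    (hp (replicate (length r) 0) - hp r)"
    using hp_replicate_0[of "length s"] assms by (simp add: algebra_simps)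
  thus ?thesis using assms by (simp add: hp_diff_path algebra_simps)
qed

text \<open>The common factor x - 1 of both differences only scales \<open>wedge\<close> by |z -
  1|^2.\<close>

lemma wedge_hp_diff:
  assumes z: "Im z > 0" and le: "list_all2 (\<le>) r s"
    and r: "set r \<subseteq> {0..1}" "sorted r" and s: "set s \<subseteq> {0..1}" "sorted s" and ne: "s \<noteq> []"
  shows "wedge (z * cev (hp s) z - cev (hp r) z) (cev (hp r) z - cev (hp s) z) \<ge> 0"
proof -
  have len: "length r = length s" using le by (rule list_all2_lengthD)
  have "wedge (cev ([:0, 1:] * hp s - hp r) z) (cev (hp r - hp s) z) \<ge> 0"
    unfolding hp_diff_path[OF len] hp_turn_diff_path[OF len ne] cev_mult wedge_mult_mult
    using wedge_hp_path[OF z le r s] by (simp only: cev_mult cev_add) simp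
  thus ?thesis by simp
qed

text \<open>In terms of \<open>q / p\<close> the inequality describes a disc, so it survives averaging numerator and
  denominator with the same weights; this is where Cauchy--Schwarz enters.\<close>

lemma wedge_diff_average:
  fixes c :: "'a \<Rightarrow> real" and u v :: "'a \<Rightarrow> complex"
  assumes z: "Im z > 0" and c: "\<And>k. k \<in> K \<Longrightarrow> c k \<ge> 0"
    and pair: "\<And>k l. k \<in> K \<Longrightarrow> l \<in> K \<Longrightarrow> wedge (z * v l - u k) (u k - v l) \<ge> 0"
  defines "p \<equiv> (\<Sum>k\<in>K. of_real (c k) * u k)" and "q \<equiv> (\<Sum>k\<in>K. of_real (c k) * v k)"
  shows "wedge (z * q - p) (p - q) \<ge> 0"
proof -
  have ex: "wedge (z * q - p) (p - q) = wedge (z * q) p + wedge p q - Im z * (cmod q)\<^sup>2" for p q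
    by (simp add: wedge_diff_left wedge_diff_right wedge_mult_self)
  have "(cmod q)\<^sup>2 \<le> (\<Sum>k\<in>K. c k * cmod (v k))\<^sup>2"
    unfolding q_def using c by (intro power_mono order.trans[OF norm_sum] sum_mono) (auto simp: norm_mult)
  \<comment> \<open>Each weight is split into two square roots, so that Cauchy-Schwarz gives |q|^2
    \<le> (sum of c_k) * (sum of c_k |v_k|^2).\<close>
  also have "(\<Sum>k\<in>K. c k * cmod (v k)) = (\<Sum>k\<in>K. sqrt (c k) * (sqrt (c k) * cmod (v k)))"
    using c by (intro sum.cong) (auto simp flip: mult.assoc)
  also have "\<dots>\<^sup>2 \<le> (\<Sum>k\<in>K. (sqrt (c k))\<^sup>2) * (\<Sum>k\<in>K. (sqrt (c k) * cmod (v k))\<^sup>2)"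
    by (rule Cauchy_Schwarz_ineq_sum)
  also have "\<dots> = (\<Sum>k\<in>K. c k) * (\<Sum>k\<in>K. c k * (cmod (v k))\<^sup>2)"
    using c by (simp add: power_mult_distrib)
  \<comment> \<open>The total weight is spread over a second index to match the double sum of the
    pairwise inequalities.\<close>
  also have "\<dots> = (\<Sum>k\<in>K. \<Sum>l\<in>K. c k * c l * (cmod (v l))\<^sup>2)"
    by (simp add: sum_product mult.assoc)
  finally have q: "Im z * (cmod q)\<^sup>2 \<le> Im z * (\<Sum>k\<in>K. \<Sum>l\<in>K. c k * c l * (cmod (v l))\<^sup>2)"
    using z by (intro mult_left_mono) auto
  have "wedge (z * q) p = (\<Sum>k\<in>K. \<Sum>l\<in>K. c k * c l * wedge (z * v l) (u k))"
  proof -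
    have "z * q = (\<Sum>k\<in>K. of_real (c k) * (z * v k))"
      by (simp add: q_def sum_distrib_left mult_ac)
    thus ?thesis
      unfolding p_def by (simp only: wedge_sum_left wedge_sum_right wedge_scale_left wedge_scale_right)
        (simp add: sum_distrib_left mult_ac)
  qed
  moreover have "wedge p q = (\<Sum>k\<in>K. \<Sum>l\<in>K. c k * c l * wedge (u k) (v l))"
    unfolding p_def q_def by (simp only: wedge_sum_left wedge_sum_right wedge_scale_left wedge_scale_right)
        (subst sum.swap, simp add: sum_distrib_left mult_ac)
  moreover have "0 \<le> (\<Sum>k\<in>K. \<Sum>l\<in>K. c k * c l * wedge (z * v l - u k) (u k - v l))"
    using c pair by (intro sum_nonneg mult_nonneg_nonneg)
  hence "0 \<le> (\<Sum>k\<in>K. \<Sum>l\<in>K. c k * c l * wedge (z * v l) (u k)) + (\<Sum>k\<in>K. \<Sum>l\<in>K. c k * c l * wedge (u k) (v l))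
     - Im z * (\<Sum>k\<in>K. \<Sum>l\<in>K. c k * c l * (cmod (v l))\<^sup>2)"
    unfolding ex by (simp add: algebra_simps sum.distrib sum_subtractf sum_distrib_left)
  ultimately show ?thesis unfolding ex using q by linarith
qed

text \<open>Reversal of degree n turns x b into the reversal of b of degree n - 1, which is b
  again.\<close>

lemma is_I_decomp_diff:
  assumes "is_I_decomp n p a b" "n \<ge> 1"
  shows "Inv_poly n p = a + b" "p - Inv_poly n p = [:-1, 1:] * b"
    "[:0, 1:] * Inv_poly n p - p = [:-1, 1:] * a"
proof -
  have "Inv_poly n ([:0, 1:] * b) = Inv_poly (n - 1) b"
    using Inv_poly_Suc_pCons[of "n - 1" b] assms(2) by simp
  thus *: "Inv_poly n p = a + b"
    using assms(1) unfolding is_I_decomp_def by (metis Inv_poly_add)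
  have "p = a + [:0, 1:] * b" using assms(1) by (simp add: is_I_decomp_def)
  thus "p - Inv_poly n p = [:-1, 1:] * b" "[:0, 1:] * Inv_poly n p - p = [:-1, 1:] * a"
    unfolding * by (simp_all add: algebra_simps)
qed

section \<open>Interlacing from the upper half-plane condition\<close>

lemma cev_of_real: "cev p (of_real x) = of_real (poly p x)"
  by (induction p) auto

lemma cev_0_iff: "(\<forall>z. cev p z = 0) \<longleftrightarrow> p = 0"
  by (metis cev_of_real of_real_eq_0_iff poly_all_0_iff_0 map_poly_0 poly_0)

lemma real_rootedI:
  assumes "\<And>z. Im z > 0 \<Longrightarrow> cev p z \<noteq> 0"
  shows "real_rooted p"
  unfolding real_rooted_def
proof (intro allI impI)
  fix z assume z: "cev p z = 0"
  hence "cev p (cnj z) = 0" by (simp add: cev_cnj)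
  with z assms[of z] assms[of "cnj z"] have "Im z = 0" by force
  thus "z \<in> \<real>" by (simp add: complex_is_Real_iff)
qed

text \<open>The zero polynomial vanishes at the imaginary unit, so this encoding does not count it
  as real-rooted.\<close>

lemma real_rooted_nonzero: "real_rooted p \<Longrightarrow> p \<noteq> 0"
  unfolding real_rooted_def by (metis cev_0_iff complex_is_Real_iff imaginary_unit.sel(2) zero_neq_one)

lemma real_rooted_minus: "real_rooted (- p) \<longleftrightarrow> real_rooted p"
  unfolding real_rooted_def cev_minus by simp

lemma real_rooted_factor:
  assumes "real_rooted p"
  shows "size (proots p) = degree p \<and> p = smult (lead_coeff p) (\<Prod>x\<in>#proots p. [:-x, 1:])"
  using assms
proof (induction "degree p" arbitrary: p)
  case 0
  then obtain c where "p = [:c:]" by (metis degree_eq_zeroE)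
  thus ?case by (simp add: one_pCons)
next
  case (Suc n)
  have "degree (map_poly complex_of_real p) = degree p" by (rule degree_map_poly) auto
  hence "\<not> constant (poly (map_poly complex_of_real p))"
    using Suc.hyps(2) by (simp add: constant_degree)
  then obtain z where z: "cev p z = 0"
    using Fundamental_Theorem_Algebra.fundamental_theorem_of_algebra[of "map_poly complex_of_real p"] by metis
  with Suc.prems obtain x where "z = of_real x" unfolding real_rooted_def by (metis Reals_cases)
  with z have "poly p x = 0" by (simp add: cev_of_real)
  then obtain q where q: "p = [:-x, 1:] * q" by (metis dvdE poly_eq_0_iff_dvd)
  have nz: "q \<noteq> 0" using real_rooted_nonzero[OF Suc.prems] q by auto
  have "real_rooted q" using Suc.prems unfolding real_rooted_def q cev_mult by auto
  moreover have deg: "degree p = Suc (degree q)" unfolding q using nz by (subst degree_mult_eq) auto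
  ultimately have IH: "size (proots q) = degree q" "q = smult (lead_coeff q) (\<Prod>x\<in>#proots q. [:-x, 1:])"
    using Suc.hyps by auto
  have roots: "proots p = add_mset x (proots q)"
    unfolding q using nz by (subst proots_mult) auto
  have lc: "lead_coeff p = lead_coeff q" unfolding q lead_coeff_mult by simp
  have "p = [:-x, 1:] * smult (lead_coeff q) (\<Prod>x\<in>#proots q. [:-x, 1:])"
    using q IH(2) by simp
  also have "\<dots> = smult (lead_coeff p) (\<Prod>x\<in>#proots p. [:-x, 1:])"
    unfolding roots lc by (simp only: mult_smult_right image_mset_add_mset prod_mset.add_mset)
  finally show ?case using roots deg IH(1) by simp
qed

lemma cev_real_rooted:
  assumes "real_rooted p"
  shows "cev p z = of_real (lead_coeff p) * (\<Prod>x\<in>#proots p. z - of_real x)"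
proof -
  have "cev (\<Prod>x\<in>#R. [:-x, 1:]) z = (\<Prod>x\<in>#R. z - of_real x)" for R
    by (induction R) (simp_all add: algebra_simps)
  thus ?thesis using real_rooted_factor[OF assms] by (metis cev_smult)
qed

text \<open>Where q is nonzero the hypothesis says Im (p / q) \<ge> 0. Near a zero of p in the upper
  half-plane p / q is holomorphic and not constant, so by the open mapping theorem it would also
  take values below the real axis.\<close>

lemma zero_free_of_wedge:
  assumes wedge: "\<And>z. Im z > 0 \<Longrightarrow> wedge (cev p z) (cev q z) \<ge> 0"
    and common: "\<And>z. Im z > 0 \<Longrightarrow> cev p z \<noteq> 0 \<or> cev q z \<noteq> 0"
    and "p \<noteq> 0" "Im z\<^sub>0 > 0"
  shows "cev p z\<^sub>0 \<noteq> 0"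
proof
  assume z0: "cev p z\<^sub>0 = 0"
  define U where "U = {z. Im z > 0} \<inter> {z. cev q z \<noteq> 0}"
  have "open U" unfolding U_def
    by (intro open_Int open_halfspace_Im_gt open_Collect_neq continuous_intros)
  moreover have "z\<^sub>0 \<in> U" using common[of z\<^sub>0] z0 assms(4) by (simp add: U_def)
  ultimately obtain r where r: "r > 0" "ball z\<^sub>0 r \<subseteq> U" by (auto simp: open_contains_ball)
  define \<phi> where "\<phi> z = cev p z / cev q z" for z
  have hol: "\<phi> holomorphic_on ball z\<^sub>0 r"
  proof -
    have "(\<lambda>z. cev p z) holomorphic_on S" for p S
      unfolding holomorphic_on_def field_differentiable_def
      using poly_DERIV has_field_derivative_at_within by blast
    thus ?thesis unfolding \<phi>_def using r by (intro holomorphic_on_divide) (auto simp: U_def)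
  qed
  have "\<not> \<phi> constant_on ball z\<^sub>0 r"
  proof
    assume "\<phi> constant_on ball z\<^sub>0 r"
    hence "\<phi> z = \<phi> z\<^sub>0" if "z \<in> ball z\<^sub>0 r" for z
      using that r(1) unfolding constant_on_def by (metis centre_in_ball)
    hence "ball z\<^sub>0 r \<subseteq> {z. cev p z = 0}"
      using r z0 by (force simp: \<phi>_def U_def)
    moreover have "map_poly complex_of_real p \<noteq> 0"
      using cev_0_iff[of p] assms(3) by auto
    hence "finite {z. cev p z = 0}" by (rule poly_roots_finite)
    ultimately have "finite (ball z\<^sub>0 r)" using finite_subset by blast
    with r(1) show False using finite_imp_not_open[of "ball z\<^sub>0 r"] by auto
  qed
  hence "open (\<phi> ` ball z\<^sub>0 r)"
    using open_mapping_thm[OF hol open_ball connected_ball open_ball order_refl] by blast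
  moreover have "0 \<in> \<phi> ` ball z\<^sub>0 r" using z0 r(1) by (force simp: \<phi>_def)
  ultimately obtain d where d: "d > 0" "ball 0 d \<subseteq> \<phi> ` ball z\<^sub>0 r"
    by (auto simp: open_contains_ball)
  have "- \<i> * of_real (d / 2) \<in> ball 0 d" using d(1) by (simp add: norm_mult)
  with d(2) have "- \<i> * of_real (d / 2) \<in> \<phi> ` ball z\<^sub>0 r" by (rule subsetD)
  then obtain w where w: "w \<in> ball z\<^sub>0 r" "\<phi> w = - \<i> * of_real (d / 2)" by (metis imageE)
  have wU: "w \<in> U" using w(1) r(2) by blast
  have "wedge (\<phi> w * cev q w) (cev q w) = - (d / 2) * (cmod (cev q w))\<^sup>2"
    unfolding wedge_mult_self w(2) by simp
  moreover have "\<phi> w * cev q w = cev p w" using wU by (simp add: \<phi>_def U_def)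
  moreover have "- (d / 2) * (cmod (cev q w))\<^sup>2 < 0" using wU d(1) by (simp add: U_def)
  ultimately show False using wedge[of w] wU by (simp add: U_def)
qed

text \<open>The argument of \<open>\<Prod>r\<in>#R. (x + \<i> * e - r)\<close>, normalised to vanish as \<open>x \<rightarrow> \<infinity>\<close>.\<close>

definition root_angle :: "real multiset \<Rightarrow> real \<Rightarrow> real \<Rightarrow> real" where
  "root_angle R e x = (\<Sum>r\<in>#R. pi / 2 - arctan ((x - r) / e))"

lemma prod_root_angle:
  assumes "e > 0"
  shows "\<exists>\<rho>>0. (\<Prod>r\<in>#R. Complex x e - of_real r) = of_real \<rho> * cis (root_angle R e x)"
proof (induction R)
  case (add r R)
  then obtain \<rho> where \<rho>: "\<rho> > 0" "(\<Prod>r\<in>#R. Complex x e - of_real r) = of_real \<rho> * cis (root_angle R e x)"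
    by blast
  define v where "v = (x - r) / e"
  have pos: "sqrt (1 + v\<^sup>2) > 0" by (simp add: add_pos_nonneg)
  \<comment> \<open>The left side is e (v + i), and v + i has argument pi / 2 - arctan v.\<close>
  have "Complex x e - of_real r = of_real (e * sqrt (1 + v\<^sup>2)) * cis (pi / 2 - arctan v)"
    using pos assms unfolding complex_eq_iff
    by (simp add: cos_diff sin_diff cos_arctan sin_arctan) (simp add: v_def)
  hence "(\<Prod>r\<in>#add_mset r R. Complex x e - of_real r) =
      of_real (e * sqrt (1 + v\<^sup>2) * \<rho>) * cis (root_angle (add_mset r R) e x)"
    using \<rho>(2) by (simp add: root_angle_def v_def[symmetric] mult_ac flip: cis_mult)
  with pos assms \<rho>(1) show ?case by (intro exI[of _ "e * sqrt (1 + v\<^sup>2) * \<rho>"]) auto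
qed (auto simp: root_angle_def intro!: exI[of _ 1])

lemma root_angle_at_top:
  assumes "e > 0"
  shows "(root_angle R e \<longlongrightarrow> 0) at_top"
proof (induction R)
  case empty
  show ?case unfolding root_angle_def by simp
next
  case (add r R)
  have "filterlim (\<lambda>x. (x - r) * (1 / e)) at_top at_top"
    using assms by (intro filterlim_at_top_mult_tendsto_pos[OF tendsto_const])
       (auto intro!: filterlim_tendsto_add_at_top[of "\<lambda>_. - r" "- r", simplified] filterlim_ident)
  hence "((\<lambda>x. pi / 2 - arctan ((x - r) / e)) \<longlongrightarrow> pi / 2 - pi / 2) at_top"
    by (intro tendsto_intros filterlim_compose[OF tendsto_arctan_at_top]) simp
  from tendsto_add[OF this add.IH] show ?case by (simp add: root_angle_def[abs_def])
qed

lemma continuous_root_angle: "continuous_on S (root_angle R e)"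
proof (induction R)
  case (add r R)
  have "continuous_on S (\<lambda>x. pi / 2 - arctan ((x - r) / e))"
    unfolding divide_inverse by (intro continuous_intros)
  from continuous_on_add[OF this add.IH] show ?case
    by (simp add: root_angle_def[abs_def])
qed (simp add: root_angle_def[abs_def])

text \<open>On the real line a linear factor has argument pi if its zero lies to the right of t, and
  0 if it lies to the left.\<close>

lemma root_angle_at_right:
  assumes "t \<notin># R"
  shows "((\<lambda>e. root_angle R e t) \<longlongrightarrow> pi * size (filter_mset (\<lambda>r. t < r) R)) (at_right 0)"
  using assms
proof (induction R)
  case empty
  show ?case by (simp add: root_angle_def)
next
  case (add r R)
  have IH: "((\<lambda>e. root_angle R e t) \<longlongrightarrow> pi * size (filter_mset (\<lambda>r. t < r) R)) (at_right 0)"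
    using add by simp
  have inv: "filterlim (\<lambda>e::real. inverse e) at_top (at_right 0)" by (rule filterlim_inverse_at_top_right)
  have "((\<lambda>e. pi / 2 - arctan ((t - r) / e)) \<longlongrightarrow> (if t < r then pi else 0)) (at_right 0)"
  proof (cases "t < r")
    case True
    have "filterlim (\<lambda>e. (t - r) * inverse e) at_bot (at_right 0)"
      using True by (intro filterlim_tendsto_neg_mult_at_bot[OF tendsto_const _ inv]) simp
    hence "((\<lambda>e. pi / 2 - arctan ((t - r) / e)) \<longlongrightarrow> pi / 2 - - (pi / 2)) (at_right 0)"
      by (intro tendsto_intros filterlim_compose[OF tendsto_arctan_at_bot]) (simp add: divide_inverse)
    thus ?thesis using True by simp
  next
    case False
    with add.prems have "t > r" by auto
    hence "filterlim (\<lambda>e. (t - r) * inverse e) at_top (at_right 0)"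
      by (intro filterlim_tendsto_pos_mult_at_top[OF tendsto_const _ inv]) simp
    hence "((\<lambda>e. pi / 2 - arctan ((t - r) / e)) \<longlongrightarrow> pi / 2 - pi / 2) (at_right 0)"
      by (intro tendsto_intros filterlim_compose[OF tendsto_arctan_at_top]) (simp add: divide_inverse)
    thus ?thesis using False by simp
  qed
  from tendsto_add[OF this IH] show ?case by (auto simp: root_angle_def algebra_simps split: if_splits)
qed

text \<open>The hypothesis says that the sine of the difference is nonnegative. The difference is
  continuous and tends to 0 at infinity, so it cannot leave [0, pi] without crossing an interval
  where the sine is negative.\<close>

lemma root_angle_diff:
  assumes "real_rooted f" "real_rooted g" "lead_coeff f * lead_coeff g > 0"
    and wedge: "\<And>z. Im z > 0 \<Longrightarrow> wedge (cev f z) (cev g z) \<ge> 0" and e: "e > 0"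
  shows "root_angle (proots f) e x - root_angle (proots g) e x \<in> {0..pi}"
proof -
  define D where "D x = root_angle (proots f) e x - root_angle (proots g) e x" for x
  have sin: "sin (D x) \<ge> 0" for x
  proof -
    obtain \<rho> where \<rho>: "\<rho> > 0" "(\<Prod>r\<in>#proots f. Complex x e - of_real r) = of_real \<rho> * cis (root_angle (proots f) e x)"
      using prod_root_angle[OF e] by blast
    obtain \<sigma> where \<sigma>: "\<sigma> > 0" "(\<Prod>r\<in>#proots g. Complex x e - of_real r) = of_real \<sigma> * cis (root_angle (proots g) e x)"
      using prod_root_angle[OF e] by blast
    have "wedge (cis \<alpha>) (cis \<beta>) = sin (\<alpha> - \<beta>)" for \<alpha> \<beta>
      by (simp add: wedge_def sin_diff)
    hence "wedge (cev f (Complex x e)) (cev g (Complex x e)) = (lead_coeff f * lead_coeff g) * (\<rho> * \<sigma>) * sin (D x)"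
      unfolding cev_real_rooted[OF assms(1)] cev_real_rooted[OF assms(2)] \<rho>(2) \<sigma>(2) D_def
        wedge_scale_left wedge_scale_right by simp
    moreover have "(lead_coeff f * lead_coeff g) * (\<rho> * \<sigma>) > 0"
      using assms(3) \<rho> \<sigma> by simp
    ultimately show ?thesis using wedge[of "Complex x e"] e by (simp add: zero_le_mult_iff)
  qed
  have cont: "continuous_on S D" for S
    unfolding D_def[abs_def] by (intro continuous_intros continuous_root_angle)
  have "(D \<longlongrightarrow> 0 - 0) at_top"
    unfolding D_def[abs_def] by (intro tendsto_diff root_angle_at_top e)
  hence lim: "(D \<longlongrightarrow> 0) at_top" by simp
  have "D x \<ge> 0"
  proof (rule ccontr)
    assume neg: "\<not> D x \<ge> 0"
    \<comment> \<open>A value in (-pi, 0) between D x and the limit 0, hence attained.\<close>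
    define c where "c = max (D x) (- pi / 2)"
    have c: "c < 0" "- pi < c" using neg by (auto simp: c_def max_def)
    have "eventually (\<lambda>y. c < D y \<and> x \<le> y) at_top"
      by (intro eventually_conj order_tendstoD(1)[OF lim c(1)] eventually_ge_at_top)
    then obtain y where "c < D y" "x \<le> y" by (metis (mono_tags, lifting) eventually_happens trivial_limit_at_top_linorder)
    moreover have "D x \<le> c" by (simp add: c_def)
    ultimately obtain w where "D w = c" using IVT'[of D x c y] cont by (metis less_imp_le)
    with sin[of w] sin_gt_zero[of "- c"] c show False by simp
  qed
  moreover have "D x \<le> pi"
  proof (rule ccontr)
    assume gt: "\<not> D x \<le> pi"
    define c where "c = min (D x) (3 / 2 * pi)"
    have c: "pi < c" "c < 2 * pi" "0 < c" using gt pi_gt_zero by (auto simp: c_def min_def)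
    have "eventually (\<lambda>y. D y < c \<and> x \<le> y) at_top"
      by (intro eventually_conj order_tendstoD(2)[OF lim c(3)] eventually_ge_at_top)
    then obtain y where "D y < c" "x \<le> y" by (metis (mono_tags, lifting) eventually_happens trivial_limit_at_top_linorder)
    moreover have "c \<le> D x" by (simp add: c_def)
    ultimately obtain w where "D w = c" using IVT2'[of D y c x] cont by (metis less_imp_le)
    with sin[of w] sin_lt_zero[of c] c show False by simp
  qed
  ultimately show ?thesis by (simp add: D_def)
qed

section \<open>From counting zeros to interlacing\<close>

definition roots_ge :: "real poly \<Rightarrow> real \<Rightarrow> nat" where
  "roots_ge p t = size (filter_mset (\<lambda>r. t \<le> r) (proots p))"

lemma roots_ge_diff:
  assumes "real_rooted f" "real_rooted g" "lead_coeff f * lead_coeff g > 0"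
    and wedge: "\<And>z. Im z > 0 \<Longrightarrow> wedge (cev f z) (cev g z) \<ge> 0"
  shows "roots_ge g t \<le> roots_ge f t" "roots_ge f t \<le> roots_ge g t + 1"
proof -
  define S where "S = set_mset (proots f + proots g)"
  \<comment> \<open>m is at least every zero below t, with t - 1 as a default. Thus the midpoint u
    is no zero, and the zeros beyond u are exactly those from t on.\<close>
  define m where "m = Max (insert (t - 1) {s \<in> S. s < t})"
  have m: "m < t" "\<And>s. s \<in> S \<Longrightarrow> s < t \<Longrightarrow> s \<le> m"
    unfolding m_def by (subst Max_less_iff) (auto simp: S_def)
  define u where "u = (m + t) / 2"
  have u: "u < t" "\<And>s. s \<in> S \<Longrightarrow> s < t \<Longrightarrow> s < u"
    using m unfolding u_def by fastforce+
  have uS: "u \<notin># proots f" "u \<notin># proots g" using u by (auto simp: S_def)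
  have eq: "size (filter_mset (\<lambda>r. u < r) (proots p)) = roots_ge p t" if "p = f \<or> p = g" for p
    unfolding roots_ge_def using that u
    by (intro arg_cong[where f = size] filter_mset_cong) (force simp: S_def not_le[symmetric])+
  have "((\<lambda>e. root_angle (proots f) e u - root_angle (proots g) e u) \<longlongrightarrow>
      pi * roots_ge f t - pi * roots_ge g t) (at_right 0)"
    using tendsto_diff[OF root_angle_at_right[OF uS(1)] root_angle_at_right[OF uS(2)]] eq by simp
  moreover have "eventually (\<lambda>e::real. e > 0) (at_right 0)" by (rule eventually_at_right_less)
  hence ev: "eventually (\<lambda>e. root_angle (proots f) e u - root_angle (proots g) e u \<in> {0..pi}) (at_right 0)"
    by eventually_elim (rule root_angle_diff[OF assms])
  ultimately have "pi * roots_ge f t - pi * roots_ge g t \<in> {0..pi}"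
    by (intro Lim_in_closed_set[OF closed_atLeastAtMost ev]) auto
  hence "0 \<le> pi * (real (roots_ge f t) - real (roots_ge g t))" "pi * (real (roots_ge f t) - real (roots_ge g t)) \<le> pi * 1"
    by (auto simp: algebra_simps)
  hence "0 \<le> real (roots_ge f t) - real (roots_ge g t)" "real (roots_ge f t) - real (roots_ge g t) \<le> 1"
    using pi_gt_zero by (auto simp: zero_le_mult_iff mult_le_cancel_left_pos)
  thus "roots_ge g t \<le> roots_ge f t" "roots_ge f t \<le> roots_ge g t + 1" by linarith+
qed

lemma sorted_desc_nth_ge_iff:
  fixes xs :: "'a :: linorder list"
  assumes "sorted_wrt (\<ge>) xs" "i < length xs"
  shows "t \<le> xs ! i \<longleftrightarrow> i < length (filter (\<lambda>r. t \<le> r) xs)"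
  using assms
proof (induction xs arbitrary: i)
  case (Cons x xs)
  show ?case
  proof (cases "t \<le> x")
    case True
    with Cons show ?thesis by (cases i) auto
  next
    case False
    with Cons.prems have lt: "\<forall>y\<in>set (x # xs). y < t" by fastforce
    hence "filter (\<lambda>r. t \<le> r) (x # xs) = []" by (auto simp: filter_empty_conv not_le)
    moreover have "(x # xs) ! i < t" using lt Cons.prems(2) nth_mem by blast
    ultimately show ?thesis by simp
  qed
qed simp

lemma length_zeros_desc: "length (zeros_desc p) = size (proots p)"
  unfolding zeros_desc_def by (metis length_rev mset_sorted_list_of_multiset size_mset)

lemma zeros_desc_ge_iff:
  assumes "i < length (zeros_desc p)"
  shows "t \<le> zeros_desc p ! i \<longleftrightarrow> i < roots_ge p t"
proof -
  have "sorted_wrt (\<ge>) (zeros_desc p)"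
    unfolding zeros_desc_def sorted_wrt_rev by simp
  moreover have "length (filter (\<lambda>r. t \<le> r) (zeros_desc p)) = roots_ge p t"
    unfolding roots_ge_def zeros_desc_def
    by (metis mset_filter mset_rev mset_sorted_list_of_multiset size_mset)
  ultimately show ?thesis using sorted_desc_nth_ge_iff[OF _ assms] by metis
qed

lemma roots_ge_eventually_degree:
  assumes "real_rooted p"
  shows "eventually (\<lambda>t. roots_ge p t = degree p) at_bot"
proof -
  have "eventually (\<lambda>t. \<forall>r\<in>set_mset (proots p). t \<le> r) at_bot"
    by (intro eventually_ball_finite ballI eventually_le_at_bot) simp
  thus ?thesis
  proof eventually_elim
    case (elim t)
    hence "filter_mset (\<lambda>r. t \<le> r) (proots p) = proots p" by (simp add: filter_mset_eq_conv)
    thus ?case using real_rooted_factor[OF assms] by (simp add: roots_ge_def)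
  qed
qed

text \<open>Taking t to be a zero turns the two count inequalities into the two chains of
  inequalities between zeros; taking t left of all zeros compares the degrees.\<close>

lemma interlacesI:
  assumes "real_rooted f" "real_rooted g"
    and le: "\<And>t. roots_ge g t \<le> roots_ge f t" "\<And>t. roots_ge f t \<le> roots_ge g t + 1"
  shows "g \<preceq> f"
proof -
  have len: "length (zeros_desc f) = degree f" "length (zeros_desc g) = degree g"
    using real_rooted_factor[OF assms(1)] real_rooted_factor[OF assms(2)] by (simp_all add: length_zeros_desc)
  obtain t where "roots_ge f t = degree f \<and> roots_ge g t = degree g"
    using eventually_happens[OF eventually_conj[OF roots_ge_eventually_degree[OF assms(1)] roots_ge_eventually_degree[OF assms(2)]]]
    by auto
  with le[of t] have deg: "degree f = degree g \<or> degree f = degree g + 1" by auto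
  have 1: "zeros_desc g ! i \<le> zeros_desc f ! i" if "i < degree f" "i < degree g" for i
    using zeros_desc_ge_iff[of i g "zeros_desc g ! i"] zeros_desc_ge_iff[of i f "zeros_desc g ! i"] le(1)[of "zeros_desc g ! i"] that len
    by auto
  have 2: "zeros_desc f ! Suc i \<le> zeros_desc g ! i" if "Suc i < degree f" "i < degree g" for i
    using zeros_desc_ge_iff[of "Suc i" f "zeros_desc f ! Suc i"] zeros_desc_ge_iff[of i g "zeros_desc f ! Suc i"] le(2)[of "zeros_desc f ! Suc i"] that len
    by auto
  from deg show ?thesis unfolding interlaces_def Let_def using assms(1,2) 1 2 by fastforce
qed

text \<open>For leading coefficients of opposite sign, \<open>wedge (- g) f = wedge f g\<close>
  exchanges the roles of the two polynomials, and - g has the zeros of g.\<close>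

lemma ll_of_wedge:
  assumes "real_rooted f" "real_rooted g"
    and wedge: "\<And>z. Im z > 0 \<Longrightarrow> wedge (cev f z) (cev g z) \<ge> 0"
  shows "g \<lless> f"
proof (cases "lead_coeff f * lead_coeff g > 0")
  case True
  have "g \<preceq> f" by (rule interlacesI[OF assms(1,2)]) (rule roots_ge_diff[OF assms(1,2) True wedge]; assumption)+
  moreover have "sgn (lead_coeff g) = sgn (lead_coeff f)"
    using True by (auto simp: zero_less_mult_iff)
  ultimately show ?thesis by (simp add: ll_def)
next
  case False
  have rr: "real_rooted (- g)" using assms(2) by (simp add: real_rooted_minus)
  have nz: "lead_coeff f \<noteq> 0" "lead_coeff g \<noteq> 0"
    using assms(1,2) real_rooted_nonzero by auto
  hence neg: "lead_coeff f * lead_coeff g < 0" using False by (simp add: not_less le_less)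
  hence pos: "lead_coeff (- g) * lead_coeff f > 0" by (simp add: mult.commute)
  have "wedge (cev (- g) z) (cev f z) \<ge> 0" if "Im z > 0" for z
    using wedge[OF that] by (simp add: wedge_def mult.commute)
  note d = roots_ge_diff[OF rr assms(1) pos this]
  have "f \<preceq> - g" by (rule interlacesI[OF rr assms(1)]) (rule d; assumption)+
  hence "f \<preceq> g" using assms(2) by (simp add: interlaces_def zeros_desc_def)
  moreover have "sgn (lead_coeff g) = - sgn (lead_coeff f)"
    using neg by (auto simp: mult_less_0_iff)
  ultimately show ?thesis by (simp add: ll_def)
qed

section \<open>Log-concavity\<close>

text \<open>Asking for all i \<le> j, and not only for neighbours, excludes sequences with internal
  zeros such as 1, 0, 0, 1.\<close>

definition log_concave :: "(nat \<Rightarrow> real) \<Rightarrow> bool" where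
  "log_concave c \<longleftrightarrow> (\<forall>i. c i \<ge> 0) \<and> (\<forall>i j. i \<le> j \<longrightarrow> c i * c (Suc j) \<le> c (Suc i) * c j)"

lemma log_concave_mult_linear:
  assumes "log_concave (coeff p)" "t \<ge> 0"
  shows "log_concave (coeff ([:t, 1:] * p))"
proof -
  define c where "c = coeff p"
  have c: "c i \<ge> 0" "i \<le> j \<Longrightarrow> c i * c (Suc j) \<le> c (Suc i) * c j" for i j
    using assms(1) by (auto simp: log_concave_def c_def)
  define d where "d = coeff ([:t, 1:] * p)"
  have d0: "d 0 = t * c 0" and dS: "d (Suc i) = c i + t * c (Suc i)" for i
    by (simp_all add: c_def d_def)
  have "d i \<ge> 0" for i using c assms(2) by (cases i) (auto simp: d0 dS)
  moreover have "d i * d (Suc j) \<le> d (Suc i) * d j" if "i \<le> j" for i j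
  proof (cases i)
    case 0
    show ?thesis
    proof (cases j)
      case (Suc m)
      have "t\<^sup>2 * (c 0 * c (Suc (Suc m))) \<le> t\<^sup>2 * (c (Suc 0) * c (Suc m))"
        by (intro mult_left_mono c) auto
      moreover have "0 \<le> c 0 * c m + t * (c (Suc 0) * c m)" using c assms(2) by simp
      ultimately show ?thesis unfolding 0 Suc d0 dS by (simp add: algebra_simps power2_eq_square)
    qed (simp add: 0)
  next
    case (Suc k)
    with that have "j = Suc (j - 1)" "k \<le> j - 1" by simp_all
    then obtain m where m: "j = Suc m" "k \<le> m" by blast
    \<comment> \<open>This settles the coefficient of t: a shift by two, made of two shifts by one
      unless k = m.\<close>
    have "c k * c (Suc (Suc m)) \<le> c (Suc (Suc k)) * c m"
    proof (cases "k = m")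
      case False
      hence "c k * c (Suc (Suc m)) \<le> c (Suc k) * c (Suc m)" "c (Suc k) * c (Suc m) \<le> c (Suc (Suc k)) * c m"
        using m by (auto intro!: c)
      thus ?thesis by simp
    qed simp
    hence "t * (c k * c (Suc (Suc m))) \<le> t * (c (Suc (Suc k)) * c m)"
      using assms(2) by (rule mult_left_mono)
    moreover have "t\<^sup>2 * (c (Suc k) * c (Suc (Suc m))) \<le> t\<^sup>2 * (c (Suc (Suc k)) * c (Suc m))"
      using m by (intro mult_left_mono c) auto
    moreover have "c k * c (Suc m) \<le> c (Suc k) * c m" using m by (intro c)
    ultimately show ?thesis unfolding Suc m d0 dS by (simp add: algebra_simps power2_eq_square)
  qed
  ultimately show ?thesis by (simp add: log_concave_def d_def)
qed

text \<open>Nonnegative coefficients exclude positive zeros, so p is a positive multiple of a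
  product of factors x + t with t \<ge> 0.\<close>

lemma real_rooted_log_concave:
  assumes "real_rooted p" and nonneg: "\<And>i. coeff p i \<ge> 0"
  shows "log_concave (coeff p)"
proof -
  have nz: "p \<noteq> 0" using assms(1) by (rule real_rooted_nonzero)
  have roots: "x \<le> 0" if "x \<in># proots p" for x
  proof (rule ccontr)
    assume x: "\<not> x \<le> 0"
    have "0 < lead_coeff p * x ^ degree p"
      using nz nonneg[of "degree p"] x by (intro mult_pos_pos zero_less_power) (auto simp: less_le)
    also have "\<dots> \<le> (\<Sum>i\<le>degree p. coeff p i * x ^ i)"
      using nonneg x by (intro member_le_sum[of "degree p" _ "\<lambda>i. coeff p i * x ^ i"]) auto
    also have "\<dots> = poly p x" by (simp add: poly_altdef)
    finally show False using that nz by simp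
  qed
  have "log_concave (coeff (\<Prod>x\<in>#R. [:-x, 1:]))" if "\<forall>x\<in>#R. x \<le> 0" for R
    using that
  proof (induction R)
    case empty
    show ?case by (auto simp: log_concave_def coeff_1)
  next
    case (add x R)
    hence "log_concave (coeff ([:-x, 1:] * (\<Prod>x\<in>#R. [:-x, 1:])))"
      by (intro log_concave_mult_linear) auto
    thus ?case by (simp only: image_mset_add_mset prod_mset.add_mset)
  qed
  hence lc0: "log_concave (coeff (\<Prod>x\<in>#proots p. [:-x, 1:]))" using roots by blast
  have lc: "log_concave (coeff (smult c (\<Prod>x\<in>#proots p. [:-x, 1:])))" if "c \<ge> 0" for c
    unfolding log_concave_def
  proof (intro conjI allI impI)
    define d where "d = coeff (\<Prod>x\<in>#proots p. [:-x, 1:])"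
    fix i j :: nat
    show "coeff (smult c (\<Prod>x\<in>#proots p. [:-x, 1:])) i \<ge> 0"
      using lc0 that by (simp add: log_concave_def)
    assume "i \<le> j"
    hence "c * c * (d i * d (Suc j)) \<le> c * c * (d (Suc i) * d j)"
      using lc0 by (intro mult_left_mono) (auto simp: log_concave_def d_def)
    thus "coeff (smult c (\<Prod>x\<in>#proots p. [:-x, 1:])) i * coeff (smult c (\<Prod>x\<in>#proots p. [:-x, 1:])) (Suc j)
       \<le> coeff (smult c (\<Prod>x\<in>#proots p. [:-x, 1:])) (Suc i) * coeff (smult c (\<Prod>x\<in>#proots p. [:-x, 1:])) j"
      unfolding coeff_smult d_def[symmetric] by (simp only: mult_ac)
  qed
  have "p = smult (lead_coeff p) (\<Prod>x\<in>#proots p. [:-x, 1:])"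
    using real_rooted_factor[OF assms(1)] by blast
  with lc[OF nonneg[of "degree p"]] show ?thesis by metis
qed

text \<open>Log-concavity at the mirrored indices i and m - i - 1 becomes, by symmetry, a comparison
  of squares.\<close>

lemma symmetric_log_concave_mono:
  assumes "log_concave (coeff f)" "Inv_poly m f = f" "2 * Suc i \<le> m"
  shows "coeff f i \<le> coeff f (Suc i)"
proof -
  have sym: "coeff f (m - j) = coeff f j" if "j \<le> m" for j
    using arg_cong[OF assms(2), of "\<lambda>f. coeff f j"] that by (simp add: coeff_Inv_poly)
  have "coeff f i * coeff f (Suc (m - Suc i)) \<le> coeff f (Suc i) * coeff f (m - Suc i)"
    using assms(1,3) by (auto simp: log_concave_def)
  moreover have "Suc (m - Suc i) = m - i" using assms(3) by simp
  ultimately have "(coeff f i)\<^sup>2 \<le> (coeff f (Suc i))\<^sup>2"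
    using sym[of i] sym[of "Suc i"] assms(3) by (simp add: power2_eq_square)
  thus ?thesis by (rule power2_le_imp_le) (use assms(1) in \<open>simp add: log_concave_def\<close>)
qed

text \<open>Consecutive differences along the chain are p_(n-i) - p_i = b_i - b_(i-1) and p_(i+1) -
  p_(n-i) = a_(i+1) - a_i, so the chain follows from the growth of b and a up to their
  middles.\<close>

lemma alternatingly_increasing_I_decomp:
  assumes "is_I_decomp n p a b" "degree p = n" "n \<ge> 1"
    and a: "a = 0 \<or> real_rooted a" "\<And>i. coeff a i \<ge> 0"
    and b: "b = 0 \<or> real_rooted b" "\<And>i. coeff b i \<ge> 0"
  shows "alternatingly_increasing p"
proof -
  define q where "q = Inv_poly n p"
  have q: "coeff q i = coeff p (n - i)" if "i \<le> n" for i using that by (simp add: q_def coeff_Inv_poly)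
  have pq: "p - q = [:-1, 1:] * b" "[:0, 1:] * q - p = [:-1, 1:] * a"
    using is_I_decomp_diff[OF assms(1,3)] by (simp_all add: q_def)
  have "coeff (p - q) (Suc i) = coeff b i - coeff b (Suc i)" for i unfolding pq by simp
  hence pq1: "coeff p (Suc i) - coeff q (Suc i) = coeff b i - coeff b (Suc i)" for i by simp
  have "coeff (p - q) 0 = - coeff b 0" unfolding pq by simp
  hence pq0: "coeff p 0 - coeff q 0 = - coeff b 0" by simp
  have "coeff ([:0, 1:] * q - p) (Suc i) = coeff a i - coeff a (Suc i)" for i unfolding pq by simp
  hence qp1: "coeff q i - coeff p (Suc i) = coeff a i - coeff a (Suc i)" for i by simp
  have amono: "coeff a i \<le> coeff a (Suc i)" if "2 * Suc i \<le> n" for i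
  proof (cases "a = 0")
    case False
    have "Inv_poly n a = a" using assms(1) by (simp add: is_I_decomp_def)
    with False a show ?thesis by (intro symmetric_log_concave_mono[OF _ _ that] real_rooted_log_concave) auto
  qed simp
  have bmono: "coeff b i \<le> coeff b (Suc i)" if "2 * Suc i \<le> n - 1" for i
  proof (cases "b = 0")
    case False
    have "Inv_poly (n - 1) b = b" using assms(1) by (simp add: is_I_decomp_def)
    with False b show ?thesis by (intro symmetric_log_concave_mono[OF _ _ that] real_rooted_log_concave) auto
  qed simp
  have "coeff p (alt_index n j) \<le> coeff p (alt_index n (Suc j))" if j: "j < n" for j
  proof (cases "even j")
    case True
    then obtain i where i: "j = 2 * i" by (elim evenE)
    have "coeff p i \<le> coeff p (n - i)"
    proof (cases i)
      case 0
      thus ?thesis using pq0 b(2)[of 0] q[of 0] by simp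
    next
      case (Suc k)
      hence "2 * Suc k \<le> n - 1" using i j by simp
      from bmono[OF this] show ?thesis using pq1[of k] q[of i] i j Suc by simp
    qed
    thus ?thesis using i by (simp add: alt_index_def)
  next
    case False
    then obtain i where i: "j = 2 * i + 1" by (elim oddE)
    have "coeff p (n - i) \<le> coeff p (Suc i)"
      using qp1[of i] amono[of i] q[of i] i j by simp
    thus ?thesis using i by (simp add: alt_index_def)
  qed
  moreover have "coeff p 0 \<ge> 0"
    using assms(1) a(2)[of 0] by (simp add: is_I_decomp_def)
  ultimately show ?thesis using assms(2) by (simp add: alternatingly_increasing_def)
qed

section \<open>Positive combinations and the final theorem\<close>

proposition hp_sum_I_decomp:
  fixes rs :: "'a \<Rightarrow> real list" and c :: "'a \<Rightarrow> real"
  assumes K: "finite K" "K \<noteq> {}" "\<And>k. k \<in> K \<Longrightarrow> c k > 0"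
    and rs: "\<And>k. k \<in> K \<Longrightarrow> length (rs k) = n" "\<And>k. k \<in> K \<Longrightarrow> set (rs k) \<subseteq> {0..1}"
      "\<And>k. k \<in> K \<Longrightarrow> sorted (rs k)"
    and le: "\<And>k l. k \<in> K \<Longrightarrow> l \<in> K \<Longrightarrow> list_all2 (\<le>) (rs k) (rev (map (\<lambda>r. 1 - r) (rs l)))"
    and n: "n \<ge> 1" and p: "p = (\<Sum>k\<in>K. smult (c k) (hp (rs k)))" and decomp: "is_I_decomp n p a b"
    and deg: "degree p = n"
  shows "Inv_poly n p \<lless> p \<and> b \<lless> a \<and> alternatingly_increasing p"
proof -
  define ss where "ss k = rev (map (\<lambda>r. 1 - r) (rs k))" for k
  define q where "q = Inv_poly n p"
  have c_nonneg: "c k \<ge> 0" if "k \<in> K" for k using K(3)[OF that] by simp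
  have ss: "length (ss k) = n" "set (ss k) \<subseteq> {0..1}" "sorted (ss k)" "ss k \<noteq> []" if "k \<in> K" for k
    using rs[OF that] n by (auto simp: ss_def sorted_iff_nth_mono rev_nth)
  have le': "list_all2 (\<le>) (rs k) (ss l)" if "k \<in> K" "l \<in> K" for k l
    using le[OF that] by (simp add: ss_def)
  have "Inv_poly n (hp (rs k)) = hp (ss k)" if "k \<in> K" for k
  proof -
    have "Inv_poly n (hp (rs k)) = hp (map (\<lambda>r. 1 - r) (rs k))"
      using Inv_poly_hp[of "rs k"] rs(1)[OF that] by simp
    also have "\<dots> = hp (ss k)" by (rule hp_mset_cong) (simp add: ss_def)
    finally show ?thesis .
  qed
  hence q_eq: "q = (\<Sum>k\<in>K. smult (c k) (hp (ss k)))"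
    unfolding q_def p Inv_poly_sum Inv_poly_smult by (intro sum.cong) auto
  have pz: "cev p z = (\<Sum>k\<in>K. of_real (c k) * cev (hp (rs k)) z)"
    and qz: "cev q z = (\<Sum>k\<in>K. of_real (c k) * cev (hp (ss k)) z)" for z
    by (simp_all add: p q_eq)
  have nonzero: "(\<Sum>k\<in>K. of_real (c k) * cev (hp (us k)) z) \<noteq> 0"
    if z: "Im z > 0" and us: "\<And>k. k \<in> K \<Longrightarrow> length (us k) = n \<and> set (us k) \<subseteq> {0..1}" for us z
  proof -
    have "arc z (cev (Eul n n) z) (\<Sum>k\<in>K. of_real (c k) * cev (hp (us k)) z)"
    proof (rule arc_sum[OF K(1,2) _ z Eul_nonzero[OF z order_refl]])
      fix k assume "k \<in> K"
      with us[OF this] arc_hp[OF z, of "us k"] K(3)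
      show "arc z (cev (Eul n n) z) (of_real (c k) * cev (hp (us k)) z)"
        by (intro arc_scale) auto
    qed
    thus ?thesis by (simp add: arc_def)
  qed
  have p_nz: "cev p z \<noteq> 0" and q_nz: "cev q z \<noteq> 0" if "Im z > 0" for z
    unfolding pz qz using that rs ss by (intro nonzero; simp)+
  have rr: "real_rooted p" "real_rooted q" using p_nz q_nz by (auto intro: real_rootedI)
  have "wedge (cev p z) (cev q z) \<ge> 0" if z: "Im z > 0" for z
    unfolding pz qz wedge_sum_left wedge_sum_right wedge_scale_left wedge_scale_right
    by (intro sum_nonneg mult_nonneg_nonneg hp_wedge_mono[OF z] le' rs ss c_nonneg)
  hence 1: "q \<lless> p" by (rule ll_of_wedge[OF rr])

  have pq: "p - q = [:-1, 1:] * b" "[:0, 1:] * q - p = [:-1, 1:] * a"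
    using is_I_decomp_diff[OF decomp n] by (simp_all add: q_def)
  have ab: "wedge (cev a z) (cev b z) \<ge> 0" if z: "Im z > 0" for z
  proof -
    have "wedge (z * cev q z - cev p z) (cev p z - cev q z) \<ge> 0"
      unfolding pz qz
      by (intro wedge_diff_average[OF z] c_nonneg wedge_hp_diff[OF z] le' rs ss)
    also have "z * cev q z - cev p z = (z - 1) * cev a z"
      using arg_cong[OF pq(2), of "\<lambda>f. cev f z"] by (simp add: algebra_simps)
    also have "cev p z - cev q z = (z - 1) * cev b z"
      using arg_cong[OF pq(1), of "\<lambda>f. cev f z"] by (simp add: algebra_simps)
    finally have "(cmod (z - 1))\<^sup>2 * wedge (cev a z) (cev b z) \<ge> 0" unfolding wedge_mult_mult .
    moreover have "z \<noteq> 1" using z by auto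
    ultimately show ?thesis by (simp add: zero_le_mult_iff)
  qed
  have pab: "cev p z = cev a z + z * cev b z" for z
    using decomp by (simp add: is_I_decomp_def)
  have common: "cev a z \<noteq> 0 \<or> cev b z \<noteq> 0" if "Im z > 0" for z
    using p_nz[OF that] by (auto simp: pab)
  have a_rr: "real_rooted a" if "a \<noteq> 0"
    using zero_free_of_wedge[OF ab common that] by (rule real_rootedI)
  have b_rr: "real_rooted b" if "b \<noteq> 0"
  proof -
    \<comment> \<open>Since \<open>wedge (- b) a = wedge a b\<close>, the criterion applies with - b
      in front.\<close>
    have "cev (- b) z \<noteq> 0" if "Im z > 0" for z
      by (rule zero_free_of_wedge[where q = a]) (use ab common that \<open>b \<noteq> 0\<close> in \<open>auto simp: wedge_def mult.commute\<close>)
    thus ?thesis by (intro real_rootedI) auto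
  qed
  have 2: "b \<lless> a"
  proof (cases "a = 0 \<or> b = 0")
    case True
    moreover have "a \<noteq> 0 \<or> b \<noteq> 0" using common[of \<i>] by auto
    ultimately show ?thesis using a_rr b_rr by (auto simp: ll_def)
  next
    case False
    thus ?thesis using ll_of_wedge[OF a_rr b_rr ab] by blast
  qed

  have len: "length (rs k) = length (ss k)" if "k \<in> K" for k using rs ss that by simp
  \<comment> \<open>Cancelling x - 1 identifies b, and below a, as positive combinations of path
    polynomials; hence their coefficients are nonnegative.\<close>
  have "[:-1, 1:] * b = [:-1, 1:] * (\<Sum>k\<in>K. smult (c k) (hp_path (rs k) (ss k)))"
    unfolding pq(1)[symmetric] unfolding p q_eq sum_subtractf[symmetric] smult_diff_right[symmetric] sum_distrib_left
    by (intro sum.cong refl) (simp only: hp_diff_path[OF len] mult_smult_right)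
  hence b_eq: "b = (\<Sum>k\<in>K. smult (c k) (hp_path (rs k) (ss k)))"
    by (simp del: mult_pCons_left)
  define A where "A k = [:0, 1:] * hp_path (ss k) (replicate n 1) + hp_path (replicate n 0) (rs k)" for k
  have "[:-1, 1:] * a = (\<Sum>k\<in>K. smult (c k) ([:0, 1:] * hp (ss k) - hp (rs k)))"
    unfolding pq(2)[symmetric] unfolding p q_eq smult_diff_right sum_subtractf sum_distrib_left mult_smult_right ..
  also have "\<dots> = [:-1, 1:] * (\<Sum>k\<in>K. smult (c k) (A k))"
    unfolding sum_distrib_left mult_smult_right A_def
    using rs ss hp_turn_diff_path[OF len] by (intro sum.cong refl arg_cong2[where f = smult]) (simp del: mult_pCons_left)
  finally have a_eq: "a = (\<Sum>k\<in>K. smult (c k) (A k))"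
    by (simp del: mult_pCons_left)
  have rep: "set (replicate n x) \<subseteq> {0..1}" if "x \<in> {0..1}" for x :: real
    using that by (cases n) auto
  have "list_all2 (\<le>) us (replicate n 1)" "list_all2 (\<le>) (replicate n 0) us" if "length us = n" "set us \<subseteq> {0..1}" for us :: "real list"
    using that nth_mem[of _ us] by (force simp: list_all2_conv_all_nth)+
  hence A_nonneg: "coeff (A k) i \<ge> 0" if "k \<in> K" for k i
    unfolding A_def using that rs[OF that] ss[OF that] rep
    by (auto simp: coeff_pCons intro!: coeff_hp_path_nonneg add_nonneg_nonneg split: nat.splits)
  hence a_nonneg: "coeff a i \<ge> 0" for i
    unfolding a_eq coeff_sum coeff_smult by (intro sum_nonneg mult_nonneg_nonneg c_nonneg A_nonneg)
  have b_nonneg: "coeff b i \<ge> 0" for i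
    unfolding b_eq coeff_sum coeff_smult
    by (intro sum_nonneg mult_nonneg_nonneg coeff_hp_path_nonneg c_nonneg le' rs ss)
  have "alternatingly_increasing p"
    using a_rr b_rr a_nonneg b_nonneg by (intro alternatingly_increasing_I_decomp[OF decomp deg n]) auto
  with 1 2 show ?thesis by (simp add: q_def)
qed

theorem theorem5p3:
  fixes n :: nat and r :: "nat \<Rightarrow> nat \<Rightarrow> real" and c :: "nat \<Rightarrow> real"
    and p a b :: "real poly"
  assumes n_pos: "n \<ge> 1"
    and r_range: "\<And>k i. k \<ge> 1 \<Longrightarrow> i \<in> {1..n} \<Longrightarrow> 0 \<le> r k i \<and> r k i \<le> 1"
    and r_mono: "\<And>k. k \<ge> 1 \<Longrightarrow> mono_on {1..n} (r k)"
    and c_fin: "finite {k. k \<ge> 1 \<and> c k \<noteq> 0}"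
    and c_nonneg: "\<And>k. k \<ge> 1 \<Longrightarrow> c k \<ge> 0"
    and p_eq: "p = (\<Sum>k | k \<ge> 1 \<and> c k \<noteq> 0. smult (c k) (hpoly n (r k)))"
    and decomp: "is_I_decomp n p a b"
    and r_sum: "\<And>k l i. k \<ge> 1 \<Longrightarrow> l \<ge> 1 \<Longrightarrow> i \<in> {1..n} \<Longrightarrow>
                  0 \<le> r k i + r l (n - i + 1) \<and> r k i + r l (n - i + 1) \<le> 1"
    and deg_p: "degree p = n"
  shows "Inv_poly n p \<lless> p \<and> b \<lless> a \<and> alternatingly_increasing p"
proof -
  define rs where "rs k = map (r k) [1..<Suc n]" for k
  have len: "length (rs k) = n" for k by (simp add: rs_def)
  have nth: "rs k ! i = r k (Suc i)" if "i < n" for k i using that by (simp add: rs_def del: upt_Suc)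
  show ?thesis
  proof (rule hp_sum_I_decomp[where K = "{k. k \<ge> 1 \<and> c k \<noteq> 0}" and c = c and rs = rs])
    show "{k. k \<ge> 1 \<and> c k \<noteq> 0} \<noteq> {}"
    proof
      assume "{k. k \<ge> 1 \<and> c k \<noteq> 0} = {}"
      hence "p = 0" using p_eq by (simp only: sum.empty)
      with deg_p n_pos show False by simp
    qed
    show "c k > 0" if "k \<in> {k. k \<ge> 1 \<and> c k \<noteq> 0}" for k using c_nonneg[of k] that by force
    show "set (rs k) \<subseteq> {0..1}" if "k \<in> {k. k \<ge> 1 \<and> c k \<noteq> 0}" for k
      using r_range[of k] that by (auto simp: rs_def simp del: upt_Suc)
    show "sorted (rs k)" if "k \<in> {k. k \<ge> 1 \<and> c k \<noteq> 0}" for k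
      using r_mono[of k] that by (auto simp: sorted_iff_nth_mono nth len intro: mono_onD)
    show "list_all2 (\<le>) (rs k) (rev (map (\<lambda>r. 1 - r) (rs l)))"
      if kl: "k \<in> {k. k \<ge> 1 \<and> c k \<noteq> 0}" "l \<in> {k. k \<ge> 1 \<and> c k \<noteq> 0}" for k l
      unfolding list_all2_conv_all_nth
    proof (intro conjI allI impI)
      fix i assume "i < length (rs k)"
      hence i: "i < n" by (simp add: len)
      \<comment> \<open>Position i from 0 carries the index i + 1, whose partner in the hypothesis
        on sums is n - (i + 1) + 1.\<close>
      hence "rev (map (\<lambda>r. 1 - r) (rs l)) ! i = 1 - r l (n - Suc i + 1)"
        by (simp add: rev_nth len nth)
      thus "rs k ! i \<le> rev (map (\<lambda>r. 1 - r) (rs l)) ! i"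
        using r_sum[of k l "Suc i"] kl i nth[of i k] by auto
    qed (simp add: len)
    show "p = (\<Sum>k | k \<ge> 1 \<and> c k \<noteq> 0. smult (c k) (hp (rs k)))"
      unfolding p_eq rs_def hpoly_conv_hp ..
  qed (use n_pos c_fin decomp deg_p len in auto)
qed

end
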